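(* Let $\phi:\mathbb{R}^d\to\mathbb{R}^d$ be an expanding linear map and let $\mathcal{T}$ be a pseudo-self-affine tiling of $\mathbb{R}^d$ with expansion $\phi$. Then for any $k\in\mathbb{N}$ sufficiently large, there exists a tiling $\mathcal{T}'$ of $\mathbb{R}^d$ which is self-affine with expansion $\phi^k$, such that $\mathcal{T}$ is mutually locally derivable (MLD) with $\mathcal{T}'$.
   Context: Tilings. Fix a finite set of types (labels) $\{1,\dots,m\}$. A tile in $\mathbb{R}^d$ is a pair $T=(A,i)$, where $A=\mathrm{supp}(T)$ is a compact set which is the closure of its interior and $i=\ell(T)\in\{1,\dots,m\}$ is its type; tiles need not be connected. A tiling of $\mathbb{R}^d$ is a set $\mathcal{T}$ of tiles whose supports cover $\mathbb{R}^d$ and such that distinct tiles have disjoint interiors. A $\mathcal{T}$-patch is a finite subset $P\subset\mathcal{T}$; $\mathrm{supp}(P)=\bigcup_{T\in P}\mathrm{supp}(T)$ and $\mathrm{diam}(P)=\mathrm{diam}(\mathrm{supp}(P))$. Translates: $(A,i)+g=(A+g,i)$ and $P+g=\{T+g: T\in P\}$. Patches (or tiles) are translationally equivalent if one is a translate of the other. For an invertible linear map $\psi$, $\psi\mathcal{T}=\{(\psi(\mathrm{supp}(T)),\ell(T)): T\in\mathcal{T}\}$. It is always assumed that any two tiles of a tiling with the same type are translationally equivalent, and that tilings have finite local complexity (FLC): for any $R>0$ there are finitely many patches of diameter less than $R$ up to translation equivalence. (The label sets of different tilings may be different finite sets.) A linear map $\phi$ is expanding if all its eigenvalues are greater than 1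 in modulus. Fix a norm $|\cdot|$ on $\mathbb{R}^d$ with $|\phi g|\ge\lambda|g|$ for all $g$, for some $\lambda>1$ (such a norm exists), and use the corresponding metric; $N_R(x)$ is the closed ball of radius $R$ centered at $x$. A tiling $\mathcal{T}$ is repetitive if for any patch $P\subset\mathcal{T}$ there is $R>0$ such that for any $x\in\mathbb{R}^d$ there is a $\mathcal{T}$-patch $P'$ which is a translate of $P$ with $\mathrm{supp}(P')\subset N_R(x)$. For $F\subset\mathbb{R}^d$ put $[F]^{\mathcal{T}}=\{T\in\mathcal{T}: \mathrm{supp}(T)\cap F\neq\emptyset\}$ and $[x]^{\mathcal{T}}=[\{x\}]^{\mathcal{T}}$. A tiling $\mathcal{T}_2$ is locally derivable (LD) from $\mathcal{T}_1$ with radius $R>0$ if for all $x,y\in\mathbb{R}^d$: $[N_R(x)]^{\mathcal{T}_1}=[N_R(y)]^{\mathcal{T}_1}+(x-y)$ implies $[x]^{\mathcal{T}_2}=[y]^{\mathcal{T}_2}+(x-y)$. $\mathcal{T}_2$ is LD from $\mathcal{T}_1$ if this holds for some $R>0$. $\mathcal{T}_1,\mathcal{T}_2$ are mutually locally derivable (MLD) if each is LD from the other. A repetitive FLC tiling $\mathcal{T}$ is pseudo-self-affine with expansion $\phi$ if $\mathcal{T}$ is LD from $\phi\mathcal{T}$. A repetitive FLC tiling $\mathcal{T}$ is self-affine with expansion $\phi$ if (i) for any tile $T=(A,i)\in\mathcal{T}$ there is a $\mathcal{T}$-patch $\omega(T)$ with $\mathrm{supp}(\omega(T))=\phi A$;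 and (ii) for any tile $T$ and $g\in\mathbb{R}^d$, if $T\in\mathcal{T}$ and $T+g\in\mathcal{T}$ then $\omega(T+g)=\omega(T)+\phi g$. *)

theory Defs
  imports "HOL-Analysis.Analysis"
begin

definition complex_eigenvalue :: "(real ^ 'n \<Rightarrow> real ^ 'n) \<Rightarrow> complex \<Rightarrow> bool" where
  "complex_eigenvalue \<phi> c \<longleftrightarrow>
    (\<exists>v :: complex ^ 'n. v \<noteq> 0 \<and> map_matrix complex_of_real (matrix \<phi>) *v v = c *s v)"

definition expanding :: "(real ^ 'n \<Rightarrow> real ^ 'n) \<Rightarrow> bool" where
  "expanding \<phi> \<longleftrightarrow> linear \<phi> \<and> (\<forall>c. complex_eigenvalue \<phi> c \<longrightarrow> cmod c > 1)"

text \<open>The metric notions below refer to a chosen norm \<open>nrm\<close> on the space, which need not be the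
  Euclidean norm of the type. Topological notions (compactness, interior, closure) do not
  depend on this choice and are the library ones.\<close>

definition is_norm :: "('v::euclidean_space \<Rightarrow> real) \<Rightarrow> bool" where
  "is_norm nrm \<longleftrightarrow>
    (\<forall>x. 0 \<le> nrm x) \<and> (\<forall>x. nrm x = 0 \<longleftrightarrow> x = 0) \<and>
    (\<forall>a x. nrm (a *\<^sub>R x) = \<bar>a\<bar> * nrm x) \<and> (\<forall>x y. nrm (x + y) \<le> nrm x + nrm y)"

definition adapted_norm :: "('v::euclidean_space \<Rightarrow> 'v) \<Rightarrow> ('v \<Rightarrow> real) \<Rightarrow> bool" where
  "adapted_norm \<phi> nrm \<longleftrightarrow> is_norm nrm \<and> (\<exists>c>1. \<forall>g. nrm (\<phi> g) \<ge> c * nrm g)"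

definition nball :: "('v::euclidean_space \<Rightarrow> real) \<Rightarrow> real \<Rightarrow> 'v \<Rightarrow> 'v set" where
  "nball nrm R x = {y. nrm (y - x) \<le> R}"

definition ndiameter :: "('v::euclidean_space \<Rightarrow> real) \<Rightarrow> 'v set \<Rightarrow> real" where
  "ndiameter nrm S = (if S = {} then 0 else SUP (x, y) \<in> S \<times> S. nrm (x - y))"

type_synonym 'v tile = "'v set \<times> nat"

definition is_tile :: "nat \<Rightarrow> 'v::euclidean_space tile \<Rightarrow> bool" where
  "is_tile m T \<longleftrightarrow> compact (fst T) \<and> closure (interior (fst T)) = fst T \<and> snd T \<in> {1..m}"

definition supp :: "'v tile set \<Rightarrow> 'v set" where
  "supp P = (\<Union>T\<in>P. fst T)"

definition translate_tile :: "'v::euclidean_space \<Rightarrow> 'v tile \<Rightarrow> 'v tile" where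
  "translate_tile g T = ((\<lambda>x. x + g) ` fst T, snd T)"

definition translate :: "'v::euclidean_space \<Rightarrow> 'v tile set \<Rightarrow> 'v tile set" where
  "translate g P = translate_tile g ` P"

definition image_tiling :: "('v \<Rightarrow> 'v) \<Rightarrow> 'v tile set \<Rightarrow> 'v tile set" where
  "image_tiling \<psi> \<T> = (\<lambda>T. (\<psi> ` fst T, snd T)) ` \<T>"

definition patch :: "'v tile set \<Rightarrow> 'v tile set \<Rightarrow> bool" where
  "patch \<T> P \<longleftrightarrow> finite P \<and> P \<subseteq> \<T>"

text \<open>The number \<open>m\<close> of labels may vary with the tiling.\<close>

definition tiling :: "'v::euclidean_space tile set \<Rightarrow> bool" where
  "tiling \<T> \<longleftrightarrow>
    (\<exists>m. \<forall>T\<in>\<T>. is_tile m T) \<and>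
    supp \<T> = UNIV \<and>
    pairwise (\<lambda>S T. interior (fst S) \<inter> interior (fst T) = {}) \<T> \<and>
    (\<forall>S\<in>\<T>. \<forall>T\<in>\<T>. snd S = snd T \<longrightarrow> (\<exists>g. T = translate_tile g S))"

definition translation_equiv :: "('v::euclidean_space tile set \<times> 'v tile set) set" where
  "translation_equiv = {(P, Q). \<exists>g. Q = translate g P}"

definition FLC :: "('v::euclidean_space \<Rightarrow> real) \<Rightarrow> 'v tile set \<Rightarrow> bool" where
  "FLC nrm \<T> \<longleftrightarrow>
    (\<forall>R>0. finite ({P. patch \<T> P \<and> ndiameter nrm (supp P) < R} // translation_equiv))"

definition repetitive :: "('v::euclidean_space \<Rightarrow> real) \<Rightarrow> 'v tile set \<Rightarrow> bool" where
  "repetitive nrm \<T> \<longleftrightarrow>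
    (\<forall>P. patch \<T> P \<longrightarrow>
      (\<exists>R>0. \<forall>x. \<exists>P'. patch \<T> P' \<and> (\<exists>g. P' = translate g P) \<and> supp P' \<subseteq> nball nrm R x))"

definition meeting :: "'v set \<Rightarrow> 'v tile set \<Rightarrow> 'v tile set" where
  "meeting F \<T> = {T \<in> \<T>. fst T \<inter> F \<noteq> {}}"

definition LD_radius ::
  "('v::euclidean_space \<Rightarrow> real) \<Rightarrow> real \<Rightarrow> 'v tile set \<Rightarrow> 'v tile set \<Rightarrow> bool" where
  "LD_radius nrm R \<T>\<^sub>2 \<T>\<^sub>1 \<longleftrightarrow>
    (\<forall>x y. meeting (nball nrm R x) \<T>\<^sub>1 = translate (x - y) (meeting (nball nrm R y) \<T>\<^sub>1) \<longrightarrow>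
           meeting {x} \<T>\<^sub>2 = translate (x - y) (meeting {y} \<T>\<^sub>2))"

text \<open>\<open>LD nrm \<T>\<^sub>2 \<T>\<^sub>1\<close>: the tiling \<open>\<T>\<^sub>2\<close> is locally derivable from \<open>\<T>\<^sub>1\<close>.\<close>

definition LD :: "('v::euclidean_space \<Rightarrow> real) \<Rightarrow> 'v tile set \<Rightarrow> 'v tile set \<Rightarrow> bool" where
  "LD nrm \<T>\<^sub>2 \<T>\<^sub>1 \<longleftrightarrow> (\<exists>R>0. LD_radius nrm R \<T>\<^sub>2 \<T>\<^sub>1)"

definition MLD :: "('v::euclidean_space \<Rightarrow> real) \<Rightarrow> 'v tile set \<Rightarrow> 'v tile set \<Rightarrow> bool" where
  "MLD nrm \<T>\<^sub>1 \<T>\<^sub>2 \<longleftrightarrow> LD nrm \<T>\<^sub>1 \<T>\<^sub>2 \<and> LD nrm \<T>\<^sub>2 \<T>\<^sub>1"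

definition pseudo_self_affine ::
  "('v::euclidean_space \<Rightarrow> real) \<Rightarrow> ('v \<Rightarrow> 'v) \<Rightarrow> 'v tile set \<Rightarrow> bool" where
  "pseudo_self_affine nrm \<phi> \<T> \<longleftrightarrow>
    tiling \<T> \<and> FLC nrm \<T> \<and> repetitive nrm \<T> \<and> LD nrm \<T> (image_tiling \<phi> \<T>)"

definition self_affine ::
  "('v::euclidean_space \<Rightarrow> real) \<Rightarrow> ('v \<Rightarrow> 'v) \<Rightarrow> 'v tile set \<Rightarrow> bool" where
  "self_affine nrm \<phi> \<T> \<longleftrightarrow>
    tiling \<T> \<and> FLC nrm \<T> \<and> repetitive nrm \<T> \<and>
    (\<exists>\<omega>. (\<forall>T\<in>\<T>. patch \<T> (\<omega> T) \<and> supp (\<omega> T) = \<phi> ` fst T) \<and>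
         (\<forall>T\<in>\<T>. \<forall>g. translate_tile g T \<in> \<T> \<longrightarrow>
            \<omega> (translate_tile g T) = translate (\<phi> g) (\<omega> T)))"

end

theory Submission
  imports Defs
begin

text \<open>
  Call the translation class of \<open>[N\<^sub>r(x)]\<close> the \<open>r\<close>-pattern of \<open>\<T>\<close> at \<open>x\<close>.
  Iterating the derivation rule shows that, with a constant \<open>\<rho>\<^sub>0\<close> independent of \<open>k\<close>, the
  \<open>(\<rho>\<^sub>0 + r)\<close>-pattern at \<open>x\<close> determines the \<open>(\<rho>\<^sub>0 + \<lambda>\<^sup>k r)\<close>-pattern at \<open>\<psi> x\<close>, where
  \<open>\<psi> = \<phi>\<^sup>k\<close>. Let \<open>\<Lambda>\<close> be the Delone set of points with the same 0-pattern as the origin, and give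
  \<open>y \<in> \<Lambda>\<close> as parent the point of \<open>\<Lambda>\<close> nearest to \<open>\<psi>\<^sup>-\<^sup>1 y\<close>. The \<open>\<rho>\<close>-pattern at a point then
  determines its children and their \<open>\<rho>\<close>-patterns, so the equations
  \<open>\<psi> (A x) = (\<Union>y \<in> children x. A y)\<close> form a graph-directed iterated function system with finitely
  many types. Its attractors \<open>A x\<close>, labelled by the \<open>\<rho>\<close>-patterns, are the tiles of \<open>\<T>'\<close>.

  Baire's theorem gives the attractors interior points. They do not overlap: two points with
  overlapping tiles lie at bounded distance, so for \<open>k\<close> large a translate of any such pair occurs
  among the children of every point. Hence an overlap of multiplicity \<open>q \<ge> 2\<close> can be
  blown up until it contains a tile, whose overlapping children turn it into an overlap of
  multiplicity \<open>q + 1\<close>; but multiplicities are bounded.\<close>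

section \<open>Norms and translations\<close>

lemma linear_funpow:
  fixes f :: "'v::real_vector \<Rightarrow> 'v"
  assumes "linear f" shows "linear (f ^^ n)"
proof (induction n)
  case (Suc n)
  then show ?case using linear_compose[OF Suc assms] by (simp only: funpow.simps)
qed (simp add: linear_id[unfolded id_def])

locale normed =
  fixes nrm :: "'v::euclidean_space \<Rightarrow> real"
  assumes is_norm: "is_norm nrm"
begin

lemma nrm_nonneg [simp]: "0 \<le> nrm x"
  using is_norm by (simp add: is_norm_def)

lemma nrm_eq_0_iff [simp]: "nrm x = 0 \<longleftrightarrow> x = 0"
  using is_norm by (simp add: is_norm_def)

lemma nrm_0 [simp]: "nrm 0 = 0"
  using nrm_eq_0_iff by blast

lemma nrm_scaleR: "nrm (a *\<^sub>R x) = \<bar>a\<bar> * nrm x"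
  using is_norm by (simp add: is_norm_def)

lemma nrm_add_le: "nrm (x + y) \<le> nrm x + nrm y"
  using is_norm by (simp add: is_norm_def)

lemma nrm_minus [simp]: "nrm (- x) = nrm x"
  using nrm_scaleR[of "-1" x] by simp

lemma nrm_minus_commute: "nrm (x - y) = nrm (y - x)"
  using nrm_minus[of "x - y"] by simp

lemma nrm_diff_triangle: "nrm (x - z) \<le> nrm (x - y) + nrm (y - z)"
  using nrm_add_le[of "x - y" "y - z"] by simp

lemma nrm_diff_le: "nrm (x - y) \<le> nrm x + nrm y"
  using nrm_diff_triangle[of x y 0] by simp

lemma funpow_expands:
  assumes "c \<ge> 0" "\<And>g. c * nrm g \<le> nrm (f g)"
  shows "c ^ n * nrm g \<le> nrm ((f ^^ n) g)"
proof (induction n)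
  case (Suc n)
  have "c ^ Suc n * nrm g \<le> c * nrm ((f ^^ n) g)"
    using Suc assms(1) by (simp add: mult.assoc mult_left_mono)
  also have "\<dots> \<le> nrm (f ((f ^^ n) g))" by (rule assms(2))
  finally show ?case by simp
qed simp

lemma nrm_le_norm: obtains C where "C > 0" "\<And>x. nrm x \<le> C * norm x"
proof
  define C where "C = (\<Sum>b\<in>Basis. nrm b) + 1"
  have "(\<Sum>b\<in>Basis. nrm b) \<ge> 0" by (simp add: sum_nonneg)
  then show "C > 0" by (simp add: C_def)
  fix x :: 'v
  have *: "nrm (\<Sum>b\<in>B. f b) \<le> (\<Sum>b\<in>B. nrm (f b))" if "finite B" for f :: "'v \<Rightarrow> 'v" and B
    using that by induction (auto intro: order_trans[OF nrm_add_le])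
  have "nrm x = nrm (\<Sum>b\<in>Basis. (x \<bullet> b) *\<^sub>R b)" by (simp add: euclidean_representation)
  also have "\<dots> \<le> (\<Sum>b\<in>Basis. \<bar>x \<bullet> b\<bar> * nrm b)"
    using *[of Basis "\<lambda>b. (x \<bullet> b) *\<^sub>R b"] by (simp add: nrm_scaleR)
  also have "\<dots> \<le> (\<Sum>b\<in>Basis. norm x * nrm b)"
    by (intro sum_mono mult_right_mono) (auto simp: Basis_le_norm)
  also have "\<dots> \<le> C * norm x"
    by (simp add: C_def sum_distrib_left[symmetric] algebra_simps)
  finally show "nrm x \<le> C * norm x" .
qed

lemma continuous_on_nrm: "continuous_on S nrm"
proof -
  obtain C where C: "C > 0" "\<And>x. nrm x \<le> C * norm x" using nrm_le_norm by blast
  have "\<bar>nrm x - nrm y\<bar> \<le> C * dist x y" for x y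
  proof -
    have "\<bar>nrm x - nrm y\<bar> \<le> nrm (x - y)"
      using nrm_diff_triangle[of x 0 y] nrm_diff_triangle[of y 0 x] nrm_minus_commute[of x y] by simp
    then show ?thesis using C(2)[of "x - y"] by (simp add: dist_norm)
  qed
  then have "C-lipschitz_on UNIV nrm"
    using C by (auto simp: lipschitz_on_def dist_real_def)
  then show ?thesis
    by (meson lipschitz_on_continuous_on continuous_on_subset top_greatest)
qed

text \<open>Together with \<open>nrm_le_norm\<close> this makes \<open>nrm\<close> equivalent to the
  Euclidean norm, so that compactness and openness can be used for the balls \<open>nball\<close>.
  The constant is the inverse of the minimum of \<open>nrm\<close> on the Euclidean unit
  sphere.\<close>

lemma norm_le_nrm: obtains C where "C > 0" "\<And>x. norm x \<le> C * nrm x"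
proof -
  have "\<exists>z\<in>sphere (0::'v) 1. \<forall>y\<in>sphere 0 1. nrm z \<le> nrm y"
    by (intro continuous_attains_inf continuous_on_nrm) auto
  then obtain z where z: "norm z = 1" "\<And>y. norm y = 1 \<Longrightarrow> nrm z \<le> nrm y" by auto
  have pos: "nrm z > 0"
    using z(1) by (metis nrm_nonneg nrm_eq_0_iff less_eq_real_def norm_zero zero_neq_one)
  have "norm x \<le> inverse (nrm z) * nrm x" for x
  proof (cases "x = 0")
    case False
    have "nrm z \<le> nrm (inverse (norm x) *\<^sub>R x)" using z(2) False by simp
    then show ?thesis using False pos by (simp add: nrm_scaleR field_simps)
  qed simp
  then show ?thesis using that pos by (meson positive_imp_inverse_positive)
qed

lemma mem_nball [simp]: "y \<in> nball nrm r x \<longleftrightarrow> nrm (y - x) \<le> r"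
  by (simp add: nball_def)

lemma nball_0: "nball nrm 0 x = {x}"
  by (auto simp: nball_def) (metis antisym_conv nrm_nonneg nrm_eq_0_iff right_minus_eq)

lemma bounded_imp_nrm_le:
  assumes "bounded S" obtains M where "M > 0" "\<And>x. x \<in> S \<Longrightarrow> nrm x \<le> M"
proof -
  obtain C where C: "C > 0" "\<And>x. nrm x \<le> C * norm x" using nrm_le_norm by blast
  obtain B where B: "B > 0" "\<And>x. x \<in> S \<Longrightarrow> norm x \<le> B" using assms by (auto simp: bounded_pos)
  show ?thesis
  proof
    show "C * B > 0" using B C by simp
    show "nrm x \<le> C * B" if "x \<in> S" for x
      using C(2)[of x] mult_left_mono[OF B(2)[OF that], of C] C(1) by linarith
  qed
qed

lemma bounded_nball: "bounded (nball nrm r x)"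
proof -
  obtain C where C: "C > 0" "\<And>x. norm x \<le> C * nrm x" using norm_le_nrm by blast
  show ?thesis unfolding bounded_any_center[where a = x]
  proof (intro exI ballI)
    fix y assume "y \<in> nball nrm r x"
    then have "C * nrm (y - x) \<le> C * r" using C(1) by simp
    then show "dist x y \<le> C * r"
      using C(2)[of "y - x"] by (simp add: dist_norm norm_minus_commute)
  qed
qed

lemma compact_nball: "compact (nball nrm r x)"
proof -
  have "closed {y. nrm (y - x) \<le> r}"
    by (intro closed_Collect_le continuous_intros continuous_on_compose2[OF continuous_on_nrm[of UNIV]]) auto
  then show ?thesis using bounded_nball by (simp add: compact_eq_bounded_closed nball_def)
qed

lemma open_nball_less: "open {y. nrm (y - x) < r}"
  by (intro open_Collect_less continuous_intros continuous_on_compose2[OF continuous_on_nrm[of UNIV]]) auto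

lemma open_contains_nball:
  assumes "open U" "u \<in> U" obtains e where "e > 0" "nball nrm e u \<subseteq> U"
proof -
  obtain C where C: "C > 0" "\<And>x. norm x \<le> C * nrm x" using norm_le_nrm by blast
  obtain e where e: "e > 0" "cball u e \<subseteq> U" using assms open_contains_cball by blast
  have "y \<in> cball u e" if "nrm (y - u) \<le> e / C" for y
    using C(2)[of "y - u"] mult_left_mono[OF that, of C] C(1)
    by (simp add: dist_norm norm_minus_commute)
  then have "nball nrm (e / C) u \<subseteq> U" using e by (auto simp del: mem_cball)
  then show ?thesis using that[of "e / C"] e C by simp
qed

text \<open>An infinite intersection would accumulate at a point of the compact ball, but two points
  of \<open>S\<close> closer than \<delta>/2 to that point must coincide.\<close>

lemma finite_separated_Int_nball:
  assumes "\<delta> > 0" and sep: "\<And>x y. x \<in> S \<Longrightarrow> y \<in> S \<Longrightarrow> nrm (x - y) < \<delta> \<Longrightarrow> x = y"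
  shows "finite (S \<inter> nball nrm r z)"
proof (rule finite_not_islimpt_in_compact[where A = "nball nrm r z" and B = S, 
      simplified Int_commute[of _ S]])
  show "compact (nball nrm r z)" by (rule compact_nball)
  fix x assume "x \<in> nball nrm r z"
  show "\<not> x islimpt S"
  proof
    assume lim: "x islimpt S"
    define U where "U = {y. nrm (y - x) < \<delta> / 2}"
    have "open U" "x \<in> U" using \<open>\<delta> > 0\<close> open_nball_less by (simp_all add: U_def del: less_divide_eq_numeral1)
    then have "infinite (U \<inter> S)" using lim by (metis islimpt_eq_acc_point Int_commute)
    then obtain y where y: "y \<in> U \<inter> S" by (metis finite.emptyI ex_in_conv)
    have "U \<inter> S \<subseteq> {y}"
    proof
      fix w assume w: "w \<in> U \<inter> S"
      have "nrm (w - y) \<le> nrm (w - x) + nrm (x - y)" by (rule nrm_diff_triangle)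
      also have "\<dots> < \<delta>" using w y nrm_minus_commute[of x y] by (simp add: U_def)
      finally show "w \<in> {y}" using sep w y by blast
    qed
    then show False using \<open>infinite (U \<inter> S)\<close> finite_subset by blast
  qed
qed

lemma nrm_diff_le_ndiameter:
  assumes "bounded S" "x \<in> S" "y \<in> S" shows "nrm (x - y) \<le> ndiameter nrm S"
proof -
  obtain M where M: "\<And>x. x \<in> S \<Longrightarrow> nrm x \<le> M" using bounded_imp_nrm_le assms(1) by blast
  \<comment> \<open>A real supremum bounds its members only if the set is bounded above.\<close>
  have "bdd_above ((\<lambda>(x, y). nrm (x - y)) ` (S \<times> S))"
  proof (rule bdd_aboveI2)
    fix p assume "p \<in> S \<times> S"
    then show "(case p of (x, y) \<Rightarrow> nrm (x - y)) \<le> M + M"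
      using M[of "fst p"] M[of "snd p"] nrm_diff_le[of "fst p" "snd p"] by (auto simp: split_beta)
  qed
  then have "(case (x, y) of (x, y) \<Rightarrow> nrm (x - y)) \<le> (SUP (x, y)\<in>S \<times> S. nrm (x - y))"
    by (rule cSUP_upper[rotated]) (use assms in auto)
  then show ?thesis using assms by (auto simp: ndiameter_def)
qed

lemma ndiameter_le:
  assumes "\<And>x y. x \<in> S \<Longrightarrow> y \<in> S \<Longrightarrow> nrm (x - y) \<le> B" "0 \<le> B"
  shows "ndiameter nrm S \<le> B"
  unfolding ndiameter_def using assms by (auto intro!: cSUP_least)

end

section \<open>Translates of tiles and patches\<close>

lemma translate_tile_0 [simp]: "translate_tile 0 T = T"
  by (simp add: translate_tile_def)

lemma translate_tile_translate_tile [simp]: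
  "translate_tile g (translate_tile h T) = translate_tile (g + h) T"
  by (auto simp: translate_tile_def image_image algebra_simps)

lemma fst_translate_tile: "fst (translate_tile g T) = (\<lambda>x. x + g) ` fst T"
  and snd_translate_tile [simp]: "snd (translate_tile g T) = snd T"
  by (simp_all add: translate_tile_def)

lemma mem_fst_translate_tile [simp]: "x \<in> fst (translate_tile g T) \<longleftrightarrow> x - g \<in> fst T"
proof
  assume "x - g \<in> fst T"
  then have "x - g + g \<in> fst (translate_tile g T)" unfolding fst_translate_tile by blast
  then show "x \<in> fst (translate_tile g T)" by simp
qed (auto simp: fst_translate_tile)

lemma translate_0 [simp]: "translate 0 P = P"
  by (simp add: translate_def)

lemma translate_translate [simp]: "translate g (translate h P) = translate (g + h) P"
  by (simp add: translate_def image_image)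

lemma mem_translate: "T \<in> translate g P \<longleftrightarrow> translate_tile (- g) T \<in> P"
proof
  assume "translate_tile (- g) T \<in> P"
  then have "translate_tile g (translate_tile (- g) T) \<in> translate g P"
    unfolding translate_def by blast
  then show "T \<in> translate g P" by simp
qed (auto simp: translate_def)

lemma translate_eq_iff: "translate g P = translate g Q \<longleftrightarrow> P = Q"
  by (metis add.left_inverse translate_0 translate_translate)

lemma mem_supp_translate: "x \<in> supp (translate g P) \<longleftrightarrow> x - g \<in> supp P"
  by (auto simp: supp_def translate_def)

lemma equiv_translation_equiv: "equiv UNIV translation_equiv"
proof (rule equivI)
  show "refl translation_equiv"
    by (auto simp: refl_on_def translation_equiv_def intro!: exI[of _ 0])
  show "sym translation_equiv"
    by (auto simp: sym_def translation_equiv_def) (metis add.left_inverse translate_0 translate_translate)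
  show "trans translation_equiv"
    by (auto simp: trans_def translation_equiv_def)
qed auto

lemma interior_translate_tile:
  "interior (fst (translate_tile g T)) = (\<lambda>x. x + g) ` interior (fst T)"
  using interior_translation[of g "fst T"] by (simp add: fst_translate_tile add.commute)

lemma mem_interior_translate_tile [simp]:
  "x \<in> interior (fst (translate_tile g T)) \<longleftrightarrow> x - g \<in> interior (fst T)"
proof
  assume "x - g \<in> interior (fst T)"
  then have "x - g + g \<in> interior (fst (translate_tile g T))" unfolding interior_translate_tile by blast
  then show "x \<in> interior (fst (translate_tile g T))" by simp
qed (auto simp: interior_translate_tile)

text \<open>Look at a point of \<open>A\<close> farthest in the direction \<open>g - h\<close>.\<close>
lemma compact_translation_unique:
  fixes A :: "'v::euclidean_space set"
  assumes "compact A" "A \<noteq> {}" and eq: "(\<lambda>x. x + g) ` A = (\<lambda>x. x + h) ` A"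
  shows "g = h"
proof -
  have "continuous_on A (\<lambda>y. y \<bullet> (g - h))" by (intro continuous_intros)
  then obtain x where x: "x \<in> A" "\<And>y. y \<in> A \<Longrightarrow> y \<bullet> (g - h) \<le> x \<bullet> (g - h)"
    using continuous_attains_sup[OF assms(1,2), of "\<lambda>y. y \<bullet> (g - h)"]
    by blast
  have "x + g \<in> (\<lambda>x. x + h) ` A" using x(1) eq by blast
  then have "x + (g - h) \<in> A" by (auto simp: algebra_simps) 
  from x(2)[OF this] have "(g - h) \<bullet> (g - h) \<le> 0" by (simp add: inner_left_distrib)
  then have "g - h = 0" using inner_gt_zero_iff[of "g - h"] by linarith
  then show ?thesis by simp
qed

text \<open>If every \<open>x\<close> failed at some stage, the largest of these stages would
  exclude them all. This exchange of quantifiers lets the intersection of stages commute with the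
  finite unions over children.\<close>

lemma decseq_finite_choice:
  fixes F :: "nat \<Rightarrow> 'a \<Rightarrow> 'b set"
  assumes "finite X" and dec: "\<And>n x. F (Suc n) x \<subseteq> F n x" and ex: "\<And>n. \<exists>x\<in>X. z \<in> F n x"
  shows "\<exists>x\<in>X. \<forall>n. z \<in> F n x"
proof (rule ccontr)
  assume "\<not> ?thesis"
  then obtain n where n: "\<And>x. x \<in> X \<Longrightarrow> z \<notin> F (n x) x" by metis
  define N where "N = Max (n ` X)"
  obtain x where x: "x \<in> X" "z \<in> F N x" using ex by blast
  have "n x \<le> N" unfolding N_def using x \<open>finite X\<close> by simp
  then have "F N x \<subseteq> F (n x) x" by (rule lift_Suc_antimono_le[of "\<lambda>n. F n x", OF dec])
  then show False using n x by blast
qed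

text \<open>Baire's theorem for finitely many closed sets. In the induction, uniting a closed set
  with a set of empty interior yields no interior beyond that of the closed set.\<close>

lemma open_subset_finite_UN_closed:
  assumes "finite I" "\<And>i. i \<in> I \<Longrightarrow> closed (C i)"
    and "open U" "U \<noteq> {}" "U \<subseteq> (\<Union>i\<in>I. C i)"
  obtains i V where "i \<in> I" "open V" "V \<noteq> {}" "V \<subseteq> U" "V \<subseteq> C i"
proof -
  have "\<exists>i\<in>I. interior (U \<inter> C i) \<noteq> {}"
  proof (rule ccontr)
    assume no: "\<not> ?thesis"
    have "interior (U \<inter> (\<Union>i\<in>J. C i)) = {}" if "finite J" "J \<subseteq> I" for J
      using that
    proof (induction J)
      case (insert j J)
      have "interior (U \<inter> (\<Union>i\<in>insert j J. C i)) \<subseteq> interior (C j \<union> (U \<inter> (\<Union>i\<in>J. C i)))"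
        by (intro interior_mono) auto
      also have "\<dots> = interior (C j)"
        using insert assms(2) by (intro interior_closed_Un_empty_interior) auto
      finally have "interior (U \<inter> (\<Union>i\<in>insert j J. C i)) \<subseteq> U \<inter> interior (C j)"
        using interior_subset by blast
      also have "\<dots> = interior (U \<inter> C j)" using \<open>open U\<close> by (simp add: interior_open)
      finally show ?case using no insert.prems by auto
    qed simp
    from this[OF assms(1)] show False using assms(3-5) by (simp add: inf.absorb1 interior_open)
  qed
  then obtain i where "i \<in> I" "interior (U \<inter> C i) \<noteq> {}" by blast
  then show ?thesis using that[of i "interior (U \<inter> C i)"] interior_subset by blast
qed

section \<open>Delone sets with local patterns\<close>

text \<open>An abstract interface to patterns: \<open>loc r x\<close> stands for what is seen from
  \<open>x\<close> up to distance \<open>r\<close>. Here \<open>finite_loc\<close> reflects finite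
  local complexity and \<open>loc_recurs\<close> reflects repetitivity.\<close>

locale pattern = normed nrm for nrm :: "'v::euclidean_space \<Rightarrow> real" +
  fixes loc :: "real \<Rightarrow> 'v \<Rightarrow> 'p" and \<Lambda> :: "'v set" and \<delta> d :: real
  assumes loc_shift: "\<And>r s v x y. loc r x = loc r y \<Longrightarrow> s + nrm v \<le> r \<Longrightarrow> loc s (x + v) = loc s (y + v)"
    and loc_\<Lambda>: "\<And>x y. loc 0 x = loc 0 y \<Longrightarrow> x \<in> \<Lambda> \<longleftrightarrow> y \<in> \<Lambda>"
    and finite_loc: "\<And>r. finite (loc r ` \<Lambda>)"
    and loc_recurs: "\<And>r x. \<exists>L. \<forall>z. \<exists>y. nrm (y - z) \<le> L \<and> loc r x = loc r y"
    and \<delta>_pos: "\<delta> > 0"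
    and separated: "\<And>x y. x \<in> \<Lambda> \<Longrightarrow> y \<in> \<Lambda> \<Longrightarrow> nrm (x - y) < \<delta> \<Longrightarrow> x = y"
    and d_pos: "d > 0"
    and dense: "\<And>z. \<exists>x\<in>\<Lambda>. nrm (x - z) \<le> d"
begin

lemma loc_mono: "loc r x = loc r y \<Longrightarrow> s \<le> r \<Longrightarrow> loc s x = loc s y"
  using loc_shift[of r x y s 0] by simp

lemma loc_shift_\<Lambda>:
  assumes "loc r x = loc r y" "nrm v \<le> r"
  shows "x + v \<in> \<Lambda> \<longleftrightarrow> y + v \<in> \<Lambda>"
  using loc_shift[of r x y 0 v] assms by (intro loc_\<Lambda>) auto

lemma finite_\<Lambda>_nball: "finite (\<Lambda> \<inter> nball nrm r z)"
  using finite_separated_Int_nball[OF \<delta>_pos separated] by blast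

text \<open>Equal \<open>r\<close>-patterns see the same points of \<Lambda> up to translation, and
  only finitely many patterns occur.\<close>

lemma card_\<Lambda>_nball_bounded: "\<exists>N. \<forall>x\<in>\<Lambda>. card (\<Lambda> \<inter> nball nrm r x) \<le> N"
proof -
  have eq: "card (\<Lambda> \<inter> nball nrm r x) = card (\<Lambda> \<inter> nball nrm r y)" if "loc r x = loc r y" for x y
  proof (rule bij_betw_same_card[where f = "\<lambda>z. z + (y - x)"], rule bij_betwI[where g = "\<lambda>z. z + (x - y)"])
    have shift: "z + (y - x) \<in> \<Lambda> \<inter> nball nrm r y"
      if "z \<in> \<Lambda> \<inter> nball nrm r x" "loc r x = loc r y" for x y z
      using that loc_shift_\<Lambda>[of r x y "z - x"] by (simp add: algebra_simps)
    show "(\<lambda>z. z + (y - x)) \<in> \<Lambda> \<inter> nball nrm r x \<rightarrow> \<Lambda> \<inter> nball nrm r y"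
      using shift that by blast
    show "(\<lambda>z. z + (x - y)) \<in> \<Lambda> \<inter> nball nrm r y \<rightarrow> \<Lambda> \<inter> nball nrm r x"
      using shift[of _ y x] that by auto
  qed auto
  have "finite ((\<lambda>x. card (\<Lambda> \<inter> nball nrm r x)) ` \<Lambda>)"
  proof (rule finite_surj[OF finite_loc[of r]])
    show "(\<lambda>x. card (\<Lambda> \<inter> nball nrm r x)) ` \<Lambda>
        \<subseteq> (\<lambda>p. card (\<Lambda> \<inter> nball nrm r (inv_into \<Lambda> (loc r) p))) ` loc r ` \<Lambda>"
    proof (clarsimp simp: image_image)
      fix x assume "x \<in> \<Lambda>"
      then have "loc r (inv_into \<Lambda> (loc r) (loc r x)) = loc r x"
        by (intro f_inv_into_f) auto
      then show "card (\<Lambda> \<inter> nball nrm r x)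
          \<in> (\<lambda>x. card (\<Lambda> \<inter> nball nrm r (inv_into \<Lambda> (loc r) (loc r x)))) ` \<Lambda>"
        using eq \<open>x \<in> \<Lambda>\<close> by (metis (no_types, lifting) image_eqI)
    qed
  qed
  then show ?thesis
    by (meson finite_nat_set_iff_bounded_le image_eqI)
qed

text \<open>A return bound for one point serves every point with the same pattern, so it suffices to
  maximize over one representative of each of the finitely many patterns.\<close>

lemma loc_recurs_uniform:
  obtains L where "L > 0" "\<And>x z. x \<in> \<Lambda> \<Longrightarrow> \<exists>y. nrm (y - z) \<le> L \<and> loc r x = loc r y"
proof -
  obtain l where l: "\<And>x z. \<exists>y. nrm (y - z) \<le> l x \<and> loc r x = loc r y"
    using loc_recurs[of r] by metis
  define rep where "rep = inv_into \<Lambda> (loc r)"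
  define L where "L = Max (insert 1 ((\<lambda>p. l (rep p)) ` loc r ` \<Lambda>))"
  have fin: "finite (insert 1 ((\<lambda>p. l (rep p)) ` loc r ` \<Lambda>))" using finite_loc by simp
  show ?thesis
  proof
    show "L > 0" unfolding L_def using fin by (subst Max_gr_iff) auto
    fix x z assume "x \<in> \<Lambda>"
    then have "l (rep (loc r x)) \<le> L" unfolding L_def by (intro Max_ge fin) auto
    moreover have "loc r (rep (loc r x)) = loc r x"
      unfolding rep_def using \<open>x \<in> \<Lambda>\<close> by (intro f_inv_into_f) auto
    moreover obtain y where "nrm (y - z) \<le> l (rep (loc r x))" "loc r (rep (loc r x)) = loc r y"
      using l by blast
    ultimately show "\<exists>y. nrm (y - z) \<le> L \<and> loc r x = loc r y" by (intro exI[of _ y]) simp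
  qed
qed

section \<open>Nearest points of the Delone set\<close>

definition is_offset :: "'v \<Rightarrow> 'v \<Rightarrow> bool" where
  "is_offset w u \<longleftrightarrow> w + u \<in> \<Lambda> \<and> (\<forall>u'. w + u' \<in> \<Lambda> \<longrightarrow> nrm u \<le> nrm u')"

text \<open>Ties between equally near points are broken by \<open>SOME\<close> applied to the set of offsets,
  so that the choice depends only on the local pattern around \<open>w\<close>.\<close>

definition nearest :: "'v \<Rightarrow> 'v" where
  "nearest w = w + (SOME u. is_offset w u)"

lemma is_offset_nrm_le:
  assumes "is_offset w u" shows "nrm u \<le> d"
proof -
  obtain x where "x \<in> \<Lambda>" "nrm (x - w) \<le> d" using dense by blast
  moreover have "nrm u \<le> nrm (x - w)" using assms \<open>x \<in> \<Lambda>\<close> by (auto simp: is_offset_def)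
  ultimately show ?thesis by simp
qed

lemma is_offset_nearest: "is_offset w (nearest w - w)"
proof -
  obtain x where x: "x \<in> \<Lambda>" "nrm (x - w) \<le> d" using dense by blast
  have fin: "finite (\<Lambda> \<inter> nball nrm d w)" by (rule finite_\<Lambda>_nball)
  have "x \<in> \<Lambda> \<inter> nball nrm d w" using x by simp
  then obtain y where y: "y \<in> \<Lambda> \<inter> nball nrm d w"
      "\<And>z. z \<in> \<Lambda> \<inter> nball nrm d w \<Longrightarrow> nrm (y - w) \<le> nrm (z - w)"
    using arg_min_if_finite[OF fin, of "\<lambda>z. nrm (z - w)"]
    by (metis arg_min_least[OF fin] empty_iff)
  have "nrm (y - w) \<le> nrm u'" if "w + u' \<in> \<Lambda>" for u'
  proof (cases "nrm u' \<le> d")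
    case True
    then show ?thesis using y(2)[of "w + u'"] that by simp
  next
    case False
    then show ?thesis using y(1) by simp
  qed
  then have "is_offset w (y - w)" using y(1) by (auto simp: is_offset_def)
  then show ?thesis unfolding nearest_def by simp (rule someI)
qed

lemma nearest_in: "nearest w \<in> \<Lambda>"
  using is_offset_nearest[of w] by (simp add: is_offset_def)

lemma nearest_minimal: "x \<in> \<Lambda> \<Longrightarrow> nrm (nearest w - w) \<le> nrm (x - w)"
  using is_offset_nearest[of w] unfolding is_offset_def by (metis add.commute diff_add_cancel)

lemma nrm_nearest_le: "nrm (nearest w - w) \<le> d"
  by (rule is_offset_nrm_le[OF is_offset_nearest])

lemma nearest_shift:
  assumes "loc d w = loc d w'"
  shows "nearest w' = nearest w + (w' - w)"
proof -
  have *: "is_offset w' u" if "loc d w = loc d w'" "is_offset w u" for w w' u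
    unfolding is_offset_def
  proof (intro conjI allI impI)
    have u: "nrm u \<le> d" using that(2) by (rule is_offset_nrm_le)
    then show "w' + u \<in> \<Lambda>" using loc_shift_\<Lambda>[OF that(1)] that(2) by (simp add: is_offset_def)
    fix u' assume "w' + u' \<in> \<Lambda>"
    then show "nrm u \<le> nrm u'"
      using loc_shift_\<Lambda>[OF that(1), of u'] that(2) u
      by (cases "nrm u' \<le> d") (auto simp: is_offset_def)
  qed
  \<comment> \<open>Equal predicates give \<open>SOME\<close> the same value, ties included.\<close>
  have "is_offset w = is_offset w'" using *[of w w'] *[of w' w] assms by fastforce
  then show ?thesis by (simp add: nearest_def)
qed

text \<open>The nearest point is no farther from \<open>w\<close> than \<open>x\<close> is, so the
  two are less than \<delta> apart.\<close>

lemma nearest_eqI: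
  assumes "x \<in> \<Lambda>" "nrm (x - w) < \<delta> / 2" shows "nearest w = x"
proof (rule separated[OF nearest_in assms(1)])
  have "nrm (nearest w - x) \<le> nrm (nearest w - w) + nrm (w - x)" by (rule nrm_diff_triangle)
  then show "nrm (nearest w - x) < \<delta>"
    using nearest_minimal[OF assms(1), of w] assms(2) nrm_minus_commute[of w x] by linarith
qed

end

section \<open>The graph-directed iterated function system\<close>

text \<open>The constants \<open>\<rho>\<^sub>0\<close> and \<open>L\<close> do not depend on \<open>k\<close>, so \<open>\<kappa>_large\<close>, which lets the cell of
  each point of \<open>\<Lambda>\<close> contain all local configurations after inflation, holds for large \<open>k\<close>.\<close>

locale substitution = pattern nrm loc \<Lambda> \<delta> d
  for nrm :: "'v::euclidean_space \<Rightarrow> real" and loc :: "real \<Rightarrow> 'v \<Rightarrow> 'p" and \<Lambda> \<delta> d +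
  fixes \<psi> :: "'v \<Rightarrow> 'v" and \<kappa> \<rho>\<^sub>0 L :: real
  assumes linear_\<psi>: "linear \<psi>"
    and \<psi>_expands: "\<And>g. \<kappa> * nrm g \<le> nrm (\<psi> g)"
    and \<kappa>_ge: "\<kappa> \<ge> 2"
    and \<rho>\<^sub>0_nonneg: "\<rho>\<^sub>0 \<ge> 0"
    and inflate: "\<And>r x y. r \<ge> 0 \<Longrightarrow> loc (\<rho>\<^sub>0 + r) x = loc (\<rho>\<^sub>0 + r) y \<Longrightarrow>
                   loc (\<rho>\<^sub>0 + \<kappa> * r) (\<psi> x) = loc (\<rho>\<^sub>0 + \<kappa> * r) (\<psi> y)"
    and recurs_L: "\<And>a z. a \<in> \<Lambda> \<Longrightarrow> \<exists>y. nrm (y - z) \<le> L \<and> loc (\<rho>\<^sub>0 + 6 * d) a = loc (\<rho>\<^sub>0 + 6 * d) y"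
    and \<kappa>_large: "L + 4 * d < \<kappa> * (\<delta> / 2)"
begin

text \<open>The radius of the patterns that serve as tile types. The margin \<open>2 * d\<close> is
  chosen so that it is regained in each generation, see \<open>children_shift\<close>.\<close>

definition "\<rho> = \<rho>\<^sub>0 + 2 * d"

lemma inj_\<psi>: "inj \<psi>"
proof -
  have "\<psi> g = 0 \<Longrightarrow> g = 0" for g
  proof -
    assume "\<psi> g = 0"
    then have "\<kappa> * nrm g \<le> 0" using \<psi>_expands[of g] by simp
    then have "nrm g \<le> 0" using \<kappa>_ge by (simp add: mult_le_0_iff)
    then show "g = 0" by (metis nrm_nonneg nrm_eq_0_iff order_antisym)
  qed
  then show ?thesis using linear_\<psi> by (simp add: linear_injective_0)
qed

lemma surj_\<psi>: "surj \<psi>"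
  using linear_\<psi> inj_\<psi> by (rule linear_inj_imp_surj)

lemma \<psi>_inv [simp]: "\<psi> (inv \<psi> y) = y"
  using surj_\<psi> by (simp add: surj_f_inv_f)

lemma inv_\<psi> [simp]: "inv \<psi> (\<psi> x) = x"
  using inj_\<psi> by simp

lemma \<psi>_add: "\<psi> (x + y) = \<psi> x + \<psi> y" and \<psi>_diff: "\<psi> (x - y) = \<psi> x - \<psi> y"
  using linear_\<psi> by (simp_all add: linear_add linear_diff)

lemma continuous_on_\<psi>: "continuous_on S \<psi>"
  using linear_\<psi> by (simp add: linear_continuous_on linear_linear)

lemma contract: "nrm (x - inv \<psi> y) \<le> nrm (\<psi> x - y) / \<kappa>"
  using \<psi>_expands[of "x - inv \<psi> y"] \<kappa>_ge by (simp add: \<psi>_diff field_simps)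

section \<open>Parents and children\<close>

definition parent :: "'v \<Rightarrow> 'v" where "parent y = nearest (inv \<psi> y)"

definition children :: "'v \<Rightarrow> 'v set" where "children x = {y \<in> \<Lambda>. parent y = x}"

lemma children_subset: "children x \<subseteq> \<Lambda>"
  by (auto simp: children_def)

lemma parent_in: "parent y \<in> \<Lambda>"
  by (simp add: parent_def nearest_in)

lemma child_near: "y \<in> children x \<Longrightarrow> nrm (inv \<psi> y - x) \<le> d"
  using nrm_nearest_le[of "inv \<psi> y"] by (auto simp: children_def parent_def nrm_minus_commute)

lemma finite_children: "finite (children x)"
proof -
  have "compact (\<psi> ` nball nrm d x)"
    by (intro compact_continuous_image continuous_on_\<psi> compact_nball)
  then obtain M where M: "\<And>y. y \<in> \<psi> ` nball nrm d x \<Longrightarrow> nrm y \<le> M"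
    by (meson bounded_imp_nrm_le compact_imp_bounded)
  have "children x \<subseteq> \<Lambda> \<inter> nball nrm M 0"
  proof
    fix y assume y: "y \<in> children x"
    then have "\<psi> (inv \<psi> y) \<in> \<psi> ` nball nrm d x" using child_near by (intro imageI) simp
    then show "y \<in> \<Lambda> \<inter> nball nrm M 0" using M y children_subset by auto
  qed
  then show ?thesis using finite_\<Lambda>_nball finite_subset by blast
qed

text \<open>Moving from \<open>x\<close> to the preimage of a child costs \<open>d\<close> of the
  margin \<open>2 * d\<close>. The remaining pattern fixes the nearest point there, hence the
  parent, and inflation turns the remaining margin \<open>d\<close> into \<kappa> * d \<ge> 2 * d.
  So the type of a point determines the types of its children.\<close>

lemma children_shift:
  assumes "loc \<rho> x = loc \<rho> x'" "y \<in> children x"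
  shows "y + \<psi> (x' - x) \<in> children x'" "loc \<rho> y = loc \<rho> (y + \<psi> (x' - x))"
proof -
  define w where "w = inv \<psi> y"
  have "loc (\<rho>\<^sub>0 + d) (x + (w - x)) = loc (\<rho>\<^sub>0 + d) (x' + (w - x))"
    using child_near[OF assms(2)] by (intro loc_shift[OF assms(1)]) (simp add: \<rho>_def w_def)
  then have w: "loc (\<rho>\<^sub>0 + d) w = loc (\<rho>\<^sub>0 + d) (w + (x' - x))" by (simp add: algebra_simps)
  have "loc d w = loc d (w + (x' - x))" by (rule loc_mono[OF w]) (simp add: \<rho>\<^sub>0_nonneg)
  from nearest_shift[OF this] have n: "nearest (w + (x' - x)) = x'"
    using assms(2) by (simp add: children_def parent_def w_def)
  have i: "inv \<psi> (y + \<psi> (x' - x)) = w + (x' - x)"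
    using inv_\<psi>[of "w + (x' - x)"] by (simp add: \<psi>_add w_def)
  have "loc (\<rho>\<^sub>0 + \<kappa> * d) y = loc (\<rho>\<^sub>0 + \<kappa> * d) (y + \<psi> (x' - x))"
    using inflate[OF less_imp_le[OF d_pos] w] by (simp add: \<psi>_add w_def)
  then show l: "loc \<rho> y = loc \<rho> (y + \<psi> (x' - x))"
    by (rule loc_mono) (simp add: \<rho>_def d_pos \<kappa>_ge)
  have l0: "loc 0 y = loc 0 (y + \<psi> (x' - x))"
    using l by (rule loc_mono) (use \<rho>\<^sub>0_nonneg d_pos in \<open>simp add: \<rho>_def\<close>)
  show "y + \<psi> (x' - x) \<in> children x'"
    using loc_\<Lambda>[OF l0] assms(2) n i by (simp add: children_def parent_def)
qed

text \<open>The pair recurs within \<open>L + 4 * d\<close> of \<psi> x, so by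
  \<open>\<kappa>_large\<close> its preimages are closer than \<delta>/2 to \<open>x\<close>, which
  makes \<open>x\<close> the parent of both. The distance \<open>4 * d\<close> covers any two points
  with intersecting attractors.\<close>

lemma children_rich:
  assumes "x \<in> \<Lambda>" "a \<in> \<Lambda>" "b \<in> \<Lambda>" "nrm (b - a) \<le> 4 * d"
  obtains g where "a + g \<in> children x" "b + g \<in> children x"
    "loc \<rho> a = loc \<rho> (a + g)" "loc \<rho> b = loc \<rho> (b + g)"
proof -
  obtain y where y: "nrm (y - \<psi> x) \<le> L" "loc (\<rho>\<^sub>0 + 6 * d) a = loc (\<rho>\<^sub>0 + 6 * d) y"
    using recurs_L assms(2) by blast
  define g where "g = y - a"
  have child: "c + g \<in> children x" and type: "loc \<rho> c = loc \<rho> (c + g)"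
    if "c \<in> \<Lambda>" "nrm (c - a) \<le> 4 * d" for c
  proof -
    \<comment> \<open>The radius \<open>\<rho>\<^sub>0 + 6 * d\<close> equals \<rho> + 4 * d, so a
      full \<rho>-pattern is left after the shift by \<open>c - a\<close>.\<close>
    have "loc \<rho> (a + (c - a)) = loc \<rho> (y + (c - a))"
      by (rule loc_shift[OF y(2)]) (use that in \<open>simp add: \<rho>_def\<close>)
    then show *: "loc \<rho> c = loc \<rho> (c + g)" by (simp add: g_def algebra_simps)
    have l0: "loc 0 c = loc 0 (c + g)"
      using * by (rule loc_mono) (use \<rho>\<^sub>0_nonneg d_pos in \<open>simp add: \<rho>_def\<close>)
    have in_\<Lambda>: "c + g \<in> \<Lambda>" using loc_\<Lambda>[OF l0] that(1) by simp
    have "nrm (\<psi> x - (c + g)) \<le> nrm (\<psi> x - y) + nrm (y - (c + g))" by (rule nrm_diff_triangle)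
    also have "\<dots> \<le> L + 4 * d"
      using y(1) that nrm_minus_commute[of "\<psi> x" y] nrm_minus_commute[of c a] by (simp add: g_def)
    also have "\<dots> < \<kappa> * (\<delta> / 2)" by (rule \<kappa>_large)
    finally have "nrm (\<psi> x - (c + g)) / \<kappa> < \<delta> / 2" using \<kappa>_ge by (simp add: field_simps)
    with contract[of x "c + g"] have "nrm (x - inv \<psi> (c + g)) < \<delta> / 2" by (rule le_less_trans)
    then have "parent (c + g) = x" unfolding parent_def by (rule nearest_eqI[OF assms(1)])
    then show "c + g \<in> children x" using in_\<Lambda> by (simp add: children_def)
  qed
  show ?thesis
    using that[of g] child[of a] child[of b] type[of a] type[of b] assms d_pos by simp
qed

section \<open>The attractors and their covering property\<close>

primrec K :: "nat \<Rightarrow> 'v \<Rightarrow> 'v set" where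
  "K 0 x = nball nrm (2 * d) x"
| "K (Suc n) x = (\<Union>y\<in>children x. \<psi> -` K n y)"

definition A :: "'v \<Rightarrow> 'v set" where "A x = (\<Inter>n. K n x)"

text \<open>The starting radius \<open>2 * d\<close> of \<open>K\<close> is chosen for this: the
  preimage of a child is within \<open>d\<close> of \<open>x\<close>, and the child's ball shrinks
  to radius at most 2 * d / \<kappa> \<le> d.\<close>

lemma K_Suc_subset: "K (Suc n) x \<subseteq> K n x"
proof (induction n arbitrary: x)
  case 0
  show ?case
  proof
    fix z assume "z \<in> K (Suc 0) x"
    then obtain y where y: "y \<in> children x" "nrm (\<psi> z - y) \<le> 2 * d" by auto
    have "nrm (z - inv \<psi> y) \<le> 2 * d / \<kappa>"
      using contract[of z y] divide_right_mono[OF y(2), of \<kappa>] \<kappa>_ge by linarith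
    also have "\<dots> \<le> d" using \<kappa>_ge d_pos by (simp add: field_simps)
    finally show "z \<in> K 0 x"
      using child_near[OF y(1)] nrm_diff_triangle[of z x "inv \<psi> y"] by simp
  qed
next
  case (Suc n)
  then show ?case by fastforce
qed

lemma closed_K: "closed (K n x)"
proof (induction n arbitrary: x)
  case 0
  then show ?case by (simp add: compact_nball compact_imp_closed)
next
  case (Suc n)
  have "closed (\<psi> -` K n y)" for y
    using Suc continuous_on_\<psi>[of UNIV] by (simp add: continuous_closed_vimage continuous_on_eq_continuous_at)
  then show ?case using finite_children by auto
qed

lemma A_near: "z \<in> A x \<Longrightarrow> nrm (z - x) \<le> 2 * d"
  unfolding A_def using INT_D[of z "\<lambda>n. K n x" UNIV 0] by simp

lemma closed_A: "closed (A x)"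
  unfolding A_def using closed_K by auto

lemma compact_A: "compact (A x)"
proof -
  have "A x \<subseteq> nball nrm (2 * d) x" using A_near by auto
  then show ?thesis
    using compact_nball closed_A by (metis closed_Int_compact inf.orderE)
qed

text \<open>The forward direction needs one child that works at all stages at once; finiteness of
  \<open>children x\<close> provides it.\<close>

lemma mem_A_iff: "z \<in> A x \<longleftrightarrow> (\<exists>y\<in>children x. \<psi> z \<in> A y)"
proof
  assume z: "z \<in> A x"
  have "\<exists>y\<in>children x. \<forall>n. \<psi> z \<in> K n y"
  proof (rule decseq_finite_choice[where F = K, OF finite_children K_Suc_subset])
    fix n
    have "z \<in> K (Suc n) x" using z unfolding A_def by blast
    then show "\<exists>y\<in>children x. \<psi> z \<in> K n y" by auto
  qed
  then show "\<exists>y\<in>children x. \<psi> z \<in> A y" unfolding A_def by blast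
next
  assume "\<exists>y\<in>children x. \<psi> z \<in> A y"
  then have Suc: "z \<in> K (Suc n) x" for n by (auto simp: A_def)
  then have "z \<in> K n x" for n using K_Suc_subset by blast
  then show "z \<in> A x" unfolding A_def by blast
qed

lemma \<psi>_image_A: "\<psi> ` A x = (\<Union>y\<in>children x. A y)"
proof (intro equalityI subsetI)
  fix z assume "z \<in> (\<Union>y\<in>children x. A y)"
  then have "inv \<psi> z \<in> A x" using mem_A_iff[of "inv \<psi> z" x] by auto
  then show "z \<in> \<psi> ` A x" by (metis \<psi>_inv image_eqI)
qed (use mem_A_iff[THEN iffD1] in blast)

text \<open>Every stage covers the space: if \<psi> z lies in stage \<open>n\<close> at
  \<open>y\<close>, then \<open>z\<close> lies in stage \<open>n + 1\<close> at the parent of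
  \<open>y\<close>. Only finitely many centres are within \<open>2 * d\<close> of \<open>z\<close>,
  so one of them serves all stages.\<close>

lemma A_covers: "\<exists>x\<in>\<Lambda>. z \<in> A x"
proof -
  have K: "\<exists>x\<in>\<Lambda>. z \<in> K n x" for n z
  proof (induction n arbitrary: z)
    case 0
    obtain x where "x \<in> \<Lambda>" "nrm (x - z) \<le> d" using dense by blast
    then have "z \<in> K 0 x" using d_pos by (simp add: nrm_minus_commute[of z x])
    then show ?case using \<open>x \<in> \<Lambda>\<close> by blast
  next
    case (Suc n)
    obtain y where "y \<in> \<Lambda>" "\<psi> z \<in> K n y" using Suc by blast
    then have "z \<in> K (Suc n) (parent y)" by (auto simp: children_def)
    then show ?case using parent_in by blast
  qed
  have near: "nrm (z - x) \<le> 2 * d" if "z \<in> K n x" for n x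
  proof -
    have "K n x \<subseteq> K 0 x" by (rule lift_Suc_antimono_le[of "\<lambda>n. K n x", OF K_Suc_subset le0])
    then show ?thesis using that by auto
  qed
  have "\<exists>x\<in>\<Lambda> \<inter> nball nrm (2 * d) z. \<forall>n. z \<in> K n x"
  proof (rule decseq_finite_choice[where F = K, OF finite_\<Lambda>_nball K_Suc_subset])
    fix n
    obtain x where "x \<in> \<Lambda>" "z \<in> K n x" using K by blast
    then show "\<exists>x\<in>\<Lambda> \<inter> nball nrm (2 * d) z. z \<in> K n x"
      using near[of n x] nrm_minus_commute[of x z] by auto
  qed
  then show ?thesis unfolding A_def by blast
qed

text \<open>Induction on the stage: points of equal type have corresponding children, again of equal
  type.\<close>

lemma A_shift_subset:
  assumes "loc \<rho> x = loc \<rho> x'" "z \<in> A x"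
  shows "z + (x' - x) \<in> A x'"
proof -
  have "z + (x' - x) \<in> K n x'" if "loc \<rho> x = loc \<rho> x'" "z \<in> K n x" for n x x' z
    using that
  proof (induction n arbitrary: x x' z)
    case 0
    then show ?case by (simp add: algebra_simps)
  next
    case (Suc n)
    then obtain y where y: "y \<in> children x" "\<psi> z \<in> K n y" by auto
    note c = children_shift[OF Suc.prems(1) y(1)]
    have "\<psi> z + (y + \<psi> (x' - x) - y) \<in> K n (y + \<psi> (x' - x))"
      by (rule Suc.IH[OF c(2) y(2)])
    then show ?case using c(1) by (auto simp: \<psi>_add intro!: bexI[of _ "y + \<psi> (x' - x)"])
  qed
  then show ?thesis using assms unfolding A_def by blast
qed

lemma A_shift:
  assumes "loc \<rho> x = loc \<rho> x'"
  shows "A x' = (\<lambda>z. z + (x' - x)) ` A x"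
proof (intro equalityI subsetI)
  fix z assume "z \<in> A x'"
  then have "z + (x - x') \<in> A x" using A_shift_subset assms by metis
  then have "z + (x - x') + (x' - x) \<in> (\<lambda>z. z + (x' - x)) ` A x" by blast
  then show "z \<in> (\<lambda>z. z + (x' - x)) ` A x" by simp
qed (use A_shift_subset[OF assms] in auto)

section \<open>Interiors of the attractors\<close>

lemma interior_\<psi>_image: "interior (\<psi> ` S) = \<psi> ` interior S"
  by (rule interior_injective_linear_image[OF linear_\<psi> inj_\<psi>])

text \<open>Finitely many closed attractors cover a ball, so some \<open>A a\<close> has interior
  points. By \<open>children_rich\<close> every \<open>x\<close> has a child of the type of
  \<open>a\<close>, and pulling back by \<psi> gives interior points of \<open>A x\<close>.\<close>

lemma interior_A_nonempty:
  assumes "x \<in> \<Lambda>" shows "interior (A x) \<noteq> {}"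
proof -
  define U where "U = {z. nrm (z - 0) < 1}"
  have U: "open U" "0 \<in> U" unfolding U_def by (rule open_nball_less) simp
  have sub: "U \<subseteq> (\<Union>x\<in>\<Lambda> \<inter> nball nrm (2 * d + 1) 0. A x)"
  proof
    fix z assume "z \<in> U"
    obtain x where x: "x \<in> \<Lambda>" "z \<in> A x" using A_covers by blast
    have "nrm (x - 0) \<le> nrm (x - z) + nrm (z - 0)" by (rule nrm_diff_triangle)
    then show "z \<in> (\<Union>x\<in>\<Lambda> \<inter> nball nrm (2 * d + 1) 0. A x)"
      using A_near[OF x(2)] \<open>z \<in> U\<close> x
      by (auto simp: U_def nrm_minus_commute[of x z] intro!: bexI[of _ x])
  qed
  obtain a V where a: "a \<in> \<Lambda>" "open V" "V \<noteq> {}" "V \<subseteq> A a"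
    by (rule open_subset_finite_UN_closed[OF finite_\<Lambda>_nball[of "2 * d + 1" 0], of A U])
       (use U sub closed_A in auto)
  obtain g where g: "a + g \<in> children x" "loc \<rho> a = loc \<rho> (a + g)"
    using children_rich[OF assms a(1) a(1)] d_pos by auto
  have "interior (A (a + g)) = (\<lambda>z. z + g) ` interior (A a)"
    using A_shift[OF g(2)] interior_translation[of g "A a"] by (simp add: add.commute)
  moreover have "interior (A a) \<noteq> {}" using a interior_maximal by blast
  moreover have "interior (A (a + g)) \<subseteq> interior (\<psi> ` A x)"
    using g(1) \<psi>_image_A by (intro interior_mono) auto
  ultimately show ?thesis by (auto simp: interior_\<psi>_image)
qed

text \<open>After \<open>n\<close> inflations some interior point lies within the diameter bound
  \<open>4 * d\<close> of the image of \<open>z\<close>; pulling it back brings it within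
  \<open>4 * d / \<kappa> ^ n\<close> of \<open>z\<close>.\<close>

lemma closure_interior_A:
  assumes "x \<in> \<Lambda>" shows "closure (interior (A x)) = A x"
proof
  show "closure (interior (A x)) \<subseteq> A x"
    by (simp add: closure_minimal closed_A interior_subset)
  have near: "\<exists>w\<in>interior (A x). nrm (w - z) \<le> 4 * d / \<kappa> ^ n" if "x \<in> \<Lambda>" "z \<in> A x" for n x z
    using that
  proof (induction n arbitrary: x z)
    case 0
    obtain w where w: "w \<in> interior (A x)" using interior_A_nonempty 0 by blast
    have "nrm (w - z) \<le> nrm (w - x) + nrm (x - z)" by (rule nrm_diff_triangle)
    also have "\<dots> \<le> 4 * d"
      using A_near[of w x] A_near[of z x] w 0 interior_subset nrm_minus_commute[of x z] by fastforce
    finally show ?case using w by auto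
  next
    case (Suc n)
    obtain y where y: "y \<in> children x" "\<psi> z \<in> A y" using Suc.prems mem_A_iff by blast
    obtain w where w: "w \<in> interior (A y)" "nrm (w - \<psi> z) \<le> 4 * d / \<kappa> ^ n"
      using Suc.IH[OF _ y(2)] y(1) children_subset by blast
    have "interior (A y) \<subseteq> \<psi> ` interior (A x)"
      unfolding interior_\<psi>_image[symmetric] using y(1) \<psi>_image_A by (intro interior_mono) auto
    then obtain v where v: "v \<in> interior (A x)" "w = \<psi> v" using w(1) by blast
    have "\<kappa> * nrm (v - z) \<le> 4 * d / \<kappa> ^ n"
      using \<psi>_expands[of "v - z"] w(2) v(2) by (simp add: \<psi>_diff)
    then have "nrm (v - z) \<le> 4 * d / \<kappa> ^ Suc n" using \<kappa>_ge by (simp add: field_simps)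
    then show ?case using v(1) by blast
  qed
  show "A x \<subseteq> closure (interior (A x))"
  proof
    fix z assume z: "z \<in> A x"
    show "z \<in> closure (interior (A x))"
      unfolding closure_iff_nhds_not_empty
    proof (intro allI impI)
      fix S V assume "V \<subseteq> S" "open V" "z \<in> V"
      then obtain e where e: "e > 0" "nball nrm e z \<subseteq> V" by (meson open_contains_nball)
      obtain n where "4 * d / e < \<kappa> ^ n" using real_arch_pow[of \<kappa>] \<kappa>_ge by auto
      then have "4 * d / \<kappa> ^ n \<le> e" using e \<kappa>_ge by (simp add: field_simps)
      moreover obtain w where "w \<in> interior (A x)" "nrm (w - z) \<le> 4 * d / \<kappa> ^ n"
        using near[OF assms z] by blast
      ultimately show "interior (A x) \<inter> S \<noteq> {}" using e \<open>V \<subseteq> S\<close> by fastforce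
    qed
  qed
qed

section \<open>Descendants and the absence of overlaps\<close>

definition desc :: "nat \<Rightarrow> 'v \<Rightarrow> 'v set" where
  "desc n x = {y \<in> \<Lambda>. (parent ^^ n) y = x}"

lemma desc_0: "x \<in> \<Lambda> \<Longrightarrow> desc 0 x = {x}"
  by (auto simp: desc_def)

lemma desc_Suc: "desc (Suc n) x = (\<Union>y\<in>desc n x. children y)"
  using parent_in by (auto simp: desc_def children_def funpow_swap1 simp del: funpow.simps
      simp add: funpow_Suc_right)

lemma finite_desc: "x \<in> \<Lambda> \<Longrightarrow> finite (desc n x)"
  by (induction n) (auto simp: desc_0 desc_Suc finite_children)

lemma funpow_\<psi>_image_A: "x \<in> \<Lambda> \<Longrightarrow> (\<psi> ^^ n) ` A x = (\<Union>y\<in>desc n x. A y)"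
proof (induction n)
  case (Suc n)
  have "(\<psi> ^^ Suc n) ` A x = \<psi> ` (\<psi> ^^ n) ` A x" by (simp add: image_comp)
  also have "\<dots> = (\<Union>y\<in>desc n x. \<psi> ` A y)" using Suc by (simp only: image_UN)
  also have "\<dots> = (\<Union>y\<in>desc (Suc n) x. A y)" by (simp add: \<psi>_image_A desc_Suc)
  finally show ?case .
qed (simp add: desc_0)

lemma linear_funpow_\<psi>: "linear (\<psi> ^^ n)"
  using linear_\<psi> by (rule linear_funpow)

lemma funpow_\<psi>_expands: "\<kappa> ^ n * nrm g \<le> nrm ((\<psi> ^^ n) g)"
  using \<kappa>_ge \<psi>_expands by (intro funpow_expands) auto

text \<open>For one point of \<open>F\<close> after the other, the open set is shrunk until it lies
  in the attractor of a single descendant; finite unions of closed sets allow this.\<close>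

lemma common_refinement:
  assumes "finite F" "F \<subseteq> \<Lambda>" "open V" "V \<noteq> {}" "\<And>x. x \<in> F \<Longrightarrow> V \<subseteq> (\<psi> ^^ n) ` A x"
  obtains W y where "open W" "W \<noteq> {}" "W \<subseteq> V" "\<And>x. x \<in> F \<Longrightarrow> y x \<in> desc n x \<and> W \<subseteq> A (y x)"
  using assms
proof (induction F arbitrary: thesis)
  case empty
  then show ?case by blast
next
  case (insert x F)
  obtain W y where W: "open W" "W \<noteq> {}" "W \<subseteq> V"
      "\<And>x. x \<in> F \<Longrightarrow> y x \<in> desc n x \<and> W \<subseteq> A (y x)"
    by (rule insert.IH) (use insert.prems in auto)
  have x: "x \<in> \<Lambda>" using insert.prems by blast
  have "W \<subseteq> (\<Union>y\<in>desc n x. A y)"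
    unfolding funpow_\<psi>_image_A[OF x, symmetric] using W(3) insert.prems(5) by blast
  then obtain i W' where i: "i \<in> desc n x" "open W'" "W' \<noteq> {}" "W' \<subseteq> W" "W' \<subseteq> A i"
    using open_subset_finite_UN_closed[OF finite_desc[OF x, of n], of A W] W closed_A
    by metis
  have "(y(x := i)) z \<in> desc n z \<and> W' \<subseteq> A ((y(x := i)) z)" if "z \<in> insert x F" for z
    using that W(4)[of z] i by (cases "z = x") auto
  then show ?case using insert.prems(1)[of W' "y(x := i)"] W(3) i by blast
qed

definition overlap :: "'v set \<Rightarrow> 'v set \<Rightarrow> bool" where
  "overlap F U \<longleftrightarrow> finite F \<and> F \<subseteq> \<Lambda> \<and> open U \<and> U \<noteq> {} \<and> (\<forall>x\<in>F. U \<subseteq> A x)"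

text \<open>A common point of the attractors puts all of \<open>F\<close> within
  \<open>4 * d\<close> of any one member.\<close>

lemma overlap_card_bounded: "\<exists>N. \<forall>F U. overlap F U \<longrightarrow> card F \<le> N"
proof -
  obtain N where N: "\<And>x. x \<in> \<Lambda> \<Longrightarrow> card (\<Lambda> \<inter> nball nrm (4 * d) x) \<le> N"
    using card_\<Lambda>_nball_bounded by blast
  have "card F \<le> N" if F: "overlap F U" for F U
  proof (cases "F = {}")
    case False
    then obtain x where x: "x \<in> F" by blast
    obtain u where u: "u \<in> U" using F by (auto simp: overlap_def)
    have "F \<subseteq> \<Lambda> \<inter> nball nrm (4 * d) x"
    proof
      fix y assume y: "y \<in> F"
      have "nrm (y - x) \<le> nrm (y - u) + nrm (u - x)" by (rule nrm_diff_triangle)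
      moreover have "u \<in> A x" "u \<in> A y" "y \<in> \<Lambda>" using F x y u by (auto simp: overlap_def)
      ultimately show "y \<in> \<Lambda> \<inter> nball nrm (4 * d) x"
        using A_near[of u x] A_near[of u y] nrm_minus_commute[of y u] by simp
    qed
    then have "card F \<le> card (\<Lambda> \<inter> nball nrm (4 * d) x)" by (intro card_mono finite_\<Lambda>_nball)
    then show ?thesis using N[of x] x F by (auto simp: overlap_def)
  qed simp
  then show ?thesis by blast
qed

text \<open>Inflating an overlap until it contains a whole tile, that tile has two overlapping children
  of its own: this raises the multiplicity by one.\<close>

lemma overlap_amplify:
  assumes F: "overlap F U" and card: "card F \<ge> 2"
  obtains F' U' where "overlap F' U'" "card F' = Suc (card F)"
proof -
  have fin: "finite F" and sub: "F \<subseteq> \<Lambda>" and U: "open U" and UA: "\<And>x. x \<in> F \<Longrightarrow> U \<subseteq> A x"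
    using F by (auto simp: overlap_def)
  obtain u where u: "u \<in> U" using F by (auto simp: overlap_def)
  obtain a b where ab: "a \<in> F" "b \<in> F" "a \<noteq> b"
    using card by (metis card_le_Suc0_iff_eq fin not_less_eq_eq numeral_2_eq_2)
  obtain e where e: "e > 0" "nball nrm e u \<subseteq> U" using open_contains_nball U u by blast
  \<comment> \<open>Enough inflation to make the image of the \<open>e\<close>-ball contain a ball
    of radius \<open>4 * d\<close>, hence every attractor through its centre.\<close>
  obtain n where n: "4 * d / e < \<kappa> ^ n" using real_arch_pow[of \<kappa>] \<kappa>_ge by auto
  have big: "nball nrm (4 * d) ((\<psi> ^^ n) u) \<subseteq> (\<psi> ^^ n) ` U"
  proof
    fix z assume z: "z \<in> nball nrm (4 * d) ((\<psi> ^^ n) u)"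
    have "surj (\<psi> ^^ n)" using surj_\<psi> by (simp add: surj_fn)
    then obtain v where v: "z = (\<psi> ^^ n) v" by blast
    have "\<kappa> ^ n * nrm (v - u) \<le> nrm ((\<psi> ^^ n) (v - u))" by (rule funpow_\<psi>_expands)
    also have "\<dots> \<le> 4 * d" using z v by (simp add: linear_diff[OF linear_funpow_\<psi>])
    also have "\<dots> \<le> \<kappa> ^ n * e" using n e by (simp add: field_simps)
    finally have "nrm (v - u) \<le> e" using \<kappa>_ge by simp
    then show "z \<in> (\<psi> ^^ n) ` U" using e v by auto
  qed
  have "(\<psi> ^^ n) u \<in> (\<psi> ^^ n) ` A a" using u UA ab by blast
  then obtain y where y: "y \<in> desc n a" "(\<psi> ^^ n) u \<in> A y"
    using funpow_\<psi>_image_A ab sub by blast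
  have "y \<in> \<Lambda>" using y by (simp add: desc_def)
  \<comment> \<open>The descendant \<open>y\<close> of \<open>a\<close> is the tile swallowed by the
    inflated overlap.\<close>
  have Ay: "A y \<subseteq> (\<psi> ^^ n) ` U"
  proof -
    have "nrm (z - (\<psi> ^^ n) u) \<le> 4 * d" if "z \<in> A y" for z
      using nrm_diff_triangle[of z "(\<psi> ^^ n) u" y] A_near[OF that] A_near[OF y(2)]
        nrm_minus_commute[of y "(\<psi> ^^ n) u"] by linarith
    then show ?thesis using big by fastforce
  qed
  have "nrm (b - a) \<le> 4 * d"
    using nrm_diff_triangle[of b a u] A_near[of u a] A_near[of u b] UA u ab
      nrm_minus_commute[of b u] by force
  then obtain g where g: "a + g \<in> children y" "b + g \<in> children y"
      "loc \<rho> a = loc \<rho> (a + g)" "loc \<rho> b = loc \<rho> (b + g)"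
    using children_rich[OF \<open>y \<in> \<Lambda>\<close>, of a b] ab sub by blast
  \<comment> \<open>The points \<open>a + g\<close> and \<open>b + g\<close> have the types of
    \<open>a\<close> and \<open>b\<close>, so this translate of \<open>U\<close> lies in both of
    their attractors.\<close>
  define V where "V = (\<lambda>z. z + g) ` U"
  have V: "open V" "V \<noteq> {}" using U u open_translation[of U g] by (auto simp: V_def add.commute)
  have VA: "V \<subseteq> A (a + g)" "V \<subseteq> A (b + g)"
    using A_shift[OF g(3)] A_shift[OF g(4)] image_mono[OF UA[OF ab(1)]] image_mono[OF UA[OF ab(2)]]
    by (simp_all add: V_def)
  have Vy: "V \<subseteq> (\<psi> ^^ Suc n) ` U"
  proof -
    have "V \<subseteq> \<psi> ` A y" unfolding \<psi>_image_A using VA g by blast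
    also have "\<dots> \<subseteq> \<psi> ` (\<psi> ^^ n) ` U" using Ay by blast
    finally show ?thesis by (simp add: image_comp)
  qed
  \<comment> \<open>The other points of \<open>F\<close> also cover \<open>V\<close> after
    \<open>n + 1\<close> inflations; each of them contributes one descendant.\<close>
  obtain W c where W: "open W" "W \<noteq> {}" "W \<subseteq> V"
      "\<And>x. x \<in> F - {a} \<Longrightarrow> c x \<in> desc (Suc n) x \<and> W \<subseteq> A (c x)"
  proof (rule common_refinement[of "F - {a}" V "Suc n"])
    fix x assume "x \<in> F - {a}"
    then show "V \<subseteq> (\<psi> ^^ Suc n) ` A x" using Vy UA[of x] by blast
  qed (use fin sub V in auto)
  \<comment> \<open>The new points are told apart by their ancestor \<open>n + 1\<close> generations
    back: \<open>a\<close> is replaced by two descendants and each other member by one, in total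
    \<open>2 + (card F - 1)\<close>.\<close>
  have anc: "(parent ^^ Suc n) (a + g) = a" "(parent ^^ Suc n) (b + g) = a"
    using g y(1) by (auto simp: children_def desc_def funpow_Suc_right simp del: funpow.simps)
  have anc_c: "(parent ^^ Suc n) (c x) = x" if "x \<in> F - {a}" for x
    using W(4)[OF that] by (simp add: desc_def)
  define F' where "F' = {a + g, b + g} \<union> c ` (F - {a})"
  have "inj_on c (F - {a})" using anc_c by (metis inj_onI)
  then have cc: "card (c ` (F - {a})) = card F - 1" using ab fin by (simp add: card_image)
  have disj: "{a + g, b + g} \<inter> c ` (F - {a}) = {}"
  proof -
    have "a + g \<noteq> c x" "b + g \<noteq> c x" if "x \<in> F - {a}" for x
      using that anc anc_c[OF that] by auto
    then show ?thesis by blast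
  qed
  have "card F' = card {a + g, b + g} + card (c ` (F - {a}))"
    unfolding F'_def using fin disj by (intro card_Un_disjoint) auto
  then have "card F' = Suc (card F)" using cc ab card by simp
  moreover have "overlap F' W"
    unfolding overlap_def
  proof (intro conjI)
    show "F' \<subseteq> \<Lambda>"
      using g children_subset W(4) by (auto simp: F'_def desc_def)
    show "\<forall>x\<in>F'. W \<subseteq> A x" using VA W by (auto simp: F'_def)
  qed (use fin W in \<open>auto simp: F'_def\<close>)
  ultimately show ?thesis using that by blast
qed

lemma interiors_disjoint:
  assumes "x \<in> \<Lambda>" "y \<in> \<Lambda>" "x \<noteq> y"
  shows "interior (A x) \<inter> interior (A y) = {}"
proof (rule ccontr)
  assume "\<not> ?thesis"
  then have "overlap {x, y} (interior (A x) \<inter> interior (A y))"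
    using assms interior_subset by (auto simp: overlap_def)
  then have base: "\<exists>F U. overlap F U \<and> card F = 2"
    using assms(3) by (metis card_2_iff)
  have "\<exists>F U. overlap F U \<and> card F = 2 + n" for n
  proof (induction n)
    case 0
    then show ?case using base by simp
  next
    case (Suc n)
    then obtain F U where "overlap F U" "card F = 2 + n" by blast
    then show ?case using overlap_amplify[of F U] by (metis add_Suc_right le_add1)
  qed
  moreover obtain N where "\<forall>F U. overlap F U \<longrightarrow> card F \<le> N" using overlap_card_bounded by blast
  ultimately show False by (metis add_2_eq_Suc' add.commute not_less_eq_eq le_add1 le_SucI)
qed

section \<open>The tiling by attractors\<close>

definition numbering :: "'p \<Rightarrow> nat" where
  "numbering = (SOME h. bij_betw h (loc \<rho> ` \<Lambda>) {0..<card (loc \<rho> ` \<Lambda>)})"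

text \<open>\<open>Suc\<close> because \<open>is_tile\<close> makes labels start at 1.\<close>

definition label :: "'v \<Rightarrow> nat" where "label x = Suc (numbering (loc \<rho> x))"

definition new_tile :: "'v \<Rightarrow> 'v tile" where "new_tile x = (A x, label x)"

definition new_tiling :: "'v tile set" where "new_tiling = new_tile ` \<Lambda>"

lemma bij_numbering: "bij_betw numbering (loc \<rho> ` \<Lambda>) {0..<card (loc \<rho> ` \<Lambda>)}"
  unfolding numbering_def by (rule someI_ex[OF ex_bij_betw_finite_nat[OF finite_loc]])

lemma label_eq_iff:
  assumes "x \<in> \<Lambda>" "y \<in> \<Lambda>" shows "label x = label y \<longleftrightarrow> loc \<rho> x = loc \<rho> y"
  using bij_numbering assms by (auto simp: label_def bij_betw_def inj_on_eq_iff)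

lemma label_range: "x \<in> \<Lambda> \<Longrightarrow> label x \<in> {1..card (loc \<rho> ` \<Lambda>)}"
  using bij_betwE[OF bij_numbering] by (auto simp: label_def Suc_le_eq)

lemma fst_new_tile [simp]: "fst (new_tile x) = A x" and snd_new_tile [simp]: "snd (new_tile x) = label x"
  by (simp_all add: new_tile_def)

lemma \<rho>_nonneg: "\<rho> \<ge> 0"
  using \<rho>\<^sub>0_nonneg d_pos by (simp add: \<rho>_def)

lemma loc_\<rho>_\<Lambda>: "loc \<rho> x = loc \<rho> y \<Longrightarrow> x \<in> \<Lambda> \<longleftrightarrow> y \<in> \<Lambda>"
  using loc_\<Lambda> loc_mono \<rho>_nonneg by blast

lemma new_tile_shift:
  assumes "loc \<rho> x = loc \<rho> y"
  shows "translate_tile (y - x) (new_tile x) = new_tile y"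
  using A_shift[OF assms] assms by (simp add: new_tile_def translate_tile_def label_def)

lemma A_nonempty: "x \<in> \<Lambda> \<Longrightarrow> A x \<noteq> {}"
  using interior_A_nonempty interior_subset by blast

text \<open>The label gives back the \<rho>-pattern, and compactness of the attractor gives back the
  translation vector. A tile thus records both the position and the type of its point.\<close>

lemma translate_new_tile_eqD:
  assumes "x \<in> \<Lambda>" "y \<in> \<Lambda>" "translate_tile g (new_tile x) = new_tile y"
  shows "y = x + g" "loc \<rho> x = loc \<rho> y"
proof -
  have "label x = label y" using assms(3) by (metis snd_new_tile snd_translate_tile)
  then show l: "loc \<rho> x = loc \<rho> y" using label_eq_iff assms by blast
  have "(\<lambda>z. z + g) ` A x = (\<lambda>z. z + (y - x)) ` A x"
    using assms(3) A_shift[OF l] by (metis fst_new_tile fst_translate_tile)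
  then have "g = y - x" by (rule compact_translation_unique[OF compact_A A_nonempty[OF assms(1)]])
  then show "y = x + g" by simp
qed

lemma inj_on_new_tile: "inj_on new_tile \<Lambda>"
proof (rule inj_onI)
  fix x y assume "x \<in> \<Lambda>" "y \<in> \<Lambda>" "new_tile x = new_tile y"
  then show "x = y" using translate_new_tile_eqD(1)[of x y 0] by simp
qed

lemma tiling_new_tiling: "tiling new_tiling"
  unfolding tiling_def
proof (intro conjI ballI impI)
  have "\<forall>T\<in>new_tiling. is_tile (card (loc \<rho> ` \<Lambda>)) T"
    using compact_A closure_interior_A label_range by (auto simp: new_tiling_def is_tile_def)
  then show "\<exists>m. \<forall>T\<in>new_tiling. is_tile m T" ..
next
  show "supp new_tiling = UNIV" using A_covers by (auto simp: supp_def new_tiling_def)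
next
  show "pairwise (\<lambda>S T. interior (fst S) \<inter> interior (fst T) = {}) new_tiling"
    using interiors_disjoint unfolding pairwise_def new_tiling_def by auto
next
  fix S T assume "S \<in> new_tiling" "T \<in> new_tiling" "snd S = snd T"
  then obtain x y where "S = new_tile x" "T = new_tile y" "loc \<rho> x = loc \<rho> y"
    unfolding new_tiling_def using label_eq_iff by auto
  then show "\<exists>g. T = translate_tile g S" using new_tile_shift by metis
qed

text \<open>With \<open>M\<close> bounding the points of the patch, the pattern of radius \<rho> + M
  at the origin contains all their types, so each recurrence of that pattern carries a copy of the
  patch.\<close>

lemma repetitive_new_tiling: "repetitive nrm new_tiling"
  unfolding repetitive_def
proof (intro allI impI)
  fix P assume "patch new_tiling P"
  then obtain F where F: "finite F" "F \<subseteq> \<Lambda>" "P = new_tile ` F"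
    unfolding patch_def new_tiling_def by (meson finite_subset_image)
  obtain M where M: "M > 0" "\<And>x. x \<in> F \<Longrightarrow> nrm x \<le> M"
    using bounded_imp_nrm_le finite_imp_bounded F(1) by blast
  obtain L where L: "\<And>z. \<exists>y. nrm (y - z) \<le> L \<and> loc (\<rho> + M) 0 = loc (\<rho> + M) y"
    using loc_recurs by blast
  show "\<exists>R>0. \<forall>x. \<exists>P'. patch new_tiling P' \<and> (\<exists>g. P' = translate g P) \<and> supp P' \<subseteq> nball nrm R x"
  proof (intro exI conjI allI)
    \<comment> \<open>The radius adds the distance to the copy of the origin, from there to the
      point of a tile, and from that point across its attractor; the sign of \<open>L\<close> is not
      known.\<close>
    show "\<bar>L\<bar> + M + 2 * d > 0" using M d_pos by linarith
    fix z
    define y where "y = (SOME y. nrm (y - z) \<le> L \<and> loc (\<rho> + M) 0 = loc (\<rho> + M) y)"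
    have y: "nrm (y - z) \<le> L" "loc (\<rho> + M) 0 = loc (\<rho> + M) y"
      using someI_ex[OF L[of z]] by (simp_all add: y_def)
    have tr: "translate_tile y (new_tile f) \<in> new_tiling" if "f \<in> F" for f
    proof -
      have "loc \<rho> (0 + f) = loc \<rho> (y + f)"
        by (rule loc_shift[OF y(2)]) (use M(2)[OF that] in simp)
      then have l: "loc \<rho> f = loc \<rho> (y + f)" by simp
      then have "y + f \<in> \<Lambda>" using loc_\<rho>_\<Lambda> F(2) that by blast
      then show ?thesis using new_tile_shift[OF l] by (simp add: new_tiling_def)
    qed
    show "patch new_tiling (translate y P)"
      using tr F by (auto simp: patch_def translate_def)
    show "translate y P = translate y P" ..
    show "supp (translate y P) \<subseteq> nball nrm (\<bar>L\<bar> + M + 2 * d) z"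
    proof
      fix u assume "u \<in> supp (translate y P)"
      then obtain f where f: "f \<in> F" "u - y \<in> A f"
        unfolding mem_supp_translate F(3) by (auto simp: supp_def)
      have "nrm (u - z) \<le> nrm (u - y) + nrm (y - z)" by (rule nrm_diff_triangle)
      moreover have "nrm (u - y) \<le> nrm (u - y - f) + nrm f" using nrm_add_le[of "u - y - f" f] by simp
      ultimately show "u \<in> nball nrm (\<bar>L\<bar> + M + 2 * d) z"
        using A_near[OF f(2)] M(2)[OF f(1)] y(1) by simp
    qed
  qed
qed

text \<open>The pattern of radius \<rho> + s at one point of a patch contains the types of all its
  points. The patch can therefore be moved to the chosen representative of that pattern, around
  which only finitely many sets of tiles are available.\<close>

lemma FLC_new_tiling: "FLC nrm new_tiling"
  unfolding FLC_def
proof (intro allI impI)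
  fix R :: real assume "R > 0"
  \<comment> \<open>Each attractor stays within \<open>2 * d\<close> of its point, so the points of
    a patch of diameter below \<open>R\<close> are within \<open>R + 4 * d\<close> of each
    other.\<close>
  define s where "s = R + 4 * d"
  define rep where "rep = inv_into \<Lambda> (loc (\<rho> + s))"
  define Q where "Q = insert {} (\<Union>p\<in>loc (\<rho> + s) ` \<Lambda>. Pow (new_tile ` (\<Lambda> \<inter> nball nrm s (rep p))))"
  have "finite (\<Union>p\<in>loc (\<rho> + s) ` \<Lambda>. Pow (new_tile ` (\<Lambda> \<inter> nball nrm s (rep p))))"
    by (rule finite_UN_I[OF finite_loc]) (simp add: finite_\<Lambda>_nball)
  then have "finite Q" unfolding Q_def by simp
  have "{P. patch new_tiling P \<and> ndiameter nrm (supp P) < R} // translation_equiv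
      \<subseteq> (\<lambda>P. translation_equiv `` {P}) ` Q"
  proof
    fix X assume "X \<in> {P. patch new_tiling P \<and> ndiameter nrm (supp P) < R} // translation_equiv"
    then obtain P where P: "patch new_tiling P" "ndiameter nrm (supp P) < R"
        and X: "X = translation_equiv `` {P}"
      by (auto elim: quotientE)
    obtain F where F: "finite F" "F \<subseteq> \<Lambda>" "P = new_tile ` F"
      using P(1) unfolding patch_def new_tiling_def by (meson finite_subset_image)
    have bounded: "bounded (supp P)"
      using F(1) compact_A compact_imp_bounded by (auto simp: F(3) supp_def)
    show "X \<in> (\<lambda>P. translation_equiv `` {P}) ` Q"
    proof (cases "F = {}")
      case True
      then show ?thesis using X F(3) by (auto simp: Q_def)
    next
      case False
      then obtain f where f: "f \<in> F" by blast
      define g where "g = rep (loc (\<rho> + s) f)"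
      have g: "loc (\<rho> + s) f = loc (\<rho> + s) g"
        unfolding g_def rep_def using f F(2) by (intro f_inv_into_f[symmetric]) auto
      have tr: "translate_tile (g - f) (new_tile f') \<in> new_tile ` (\<Lambda> \<inter> nball nrm s g)" if "f' \<in> F" for f'
      proof -
        have "A f \<noteq> {}" "A f' \<noteq> {}" using A_nonempty[of f] A_nonempty[of f'] f that F(2) by auto
        then obtain a b where ab: "a \<in> A f" "b \<in> A f'" by blast
        then have "a \<in> supp P" "b \<in> supp P" using f that by (auto simp: F(3) supp_def)
        then have "nrm (b - a) < R"
          using nrm_diff_le_ndiameter[OF bounded, of b a] P(2) by linarith
        then have near: "nrm (f' - f) \<le> s"
          using nrm_diff_triangle[of f' f b] nrm_diff_triangle[of b f a] A_near[OF ab(1)] A_near[OF ab(2)]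
            nrm_minus_commute[of f' b] by (simp add: s_def)
        have "loc \<rho> (f + (f' - f)) = loc \<rho> (g + (f' - f))"
          by (rule loc_shift[OF g]) (use near in simp)
        then have l: "loc \<rho> f' = loc \<rho> (f' + (g - f))" by (simp add: algebra_simps)
        then have "f' + (g - f) \<in> \<Lambda> \<inter> nball nrm s g"
          using loc_\<rho>_\<Lambda>[OF l] that F(2) near by (auto simp: algebra_simps)
        moreover have "translate_tile (g - f) (new_tile f') = new_tile (f' + (g - f))"
          using new_tile_shift[OF l] by simp
        ultimately show ?thesis by simp
      qed
      have "translate (g - f) P \<subseteq> new_tile ` (\<Lambda> \<inter> nball nrm s g)"
        using tr by (auto simp: translate_def F(3))
      then have "translate (g - f) P \<in> Q" using f F(2) by (auto simp: Q_def g_def)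
      moreover have "(P, translate (g - f) P) \<in> translation_equiv" by (auto simp: translation_equiv_def)
      then have "X = translation_equiv `` {translate (g - f) P}"
        unfolding X by (rule equiv_class_eq[OF equiv_translation_equiv])
      ultimately show ?thesis by blast
    qed
  qed
  then show "finite ({P. patch new_tiling P \<and> ndiameter nrm (supp P) < R} // translation_equiv)"
    using \<open>finite Q\<close> finite_surj by blast
qed

lemma self_affine_new_tiling: "self_affine nrm \<psi> new_tiling"
  unfolding self_affine_def
proof (intro conjI exI ballI allI impI)
  \<comment> \<open>Tiles correspond one to one to points of \<Lambda>, so the substitution can be
    read off from the children of the point.\<close>
  define pos where "pos = inv_into \<Lambda> new_tile"
  have pos [simp]: "pos (new_tile x) = x" if "x \<in> \<Lambda>" for x
    using that inj_on_new_tile by (simp add: pos_def)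
  define \<omega> where "\<omega> T = new_tile ` children (pos T)" for T
  { fix T assume "T \<in> new_tiling"
    then obtain x where x: "x \<in> \<Lambda>" "T = new_tile x" by (auto simp: new_tiling_def)
    show "patch new_tiling (\<omega> T)"
      using x finite_children children_subset by (auto simp: \<omega>_def patch_def new_tiling_def)
    show "supp (\<omega> T) = \<psi> ` fst T"
      using x by (simp add: \<omega>_def supp_def \<psi>_image_A)
    fix g assume "translate_tile g T \<in> new_tiling"
    then obtain y where y: "y \<in> \<Lambda>" "translate_tile g (new_tile x) = new_tile y"
      using x by (auto simp: new_tiling_def)
    have tr: "translate_tile (\<psi> (y - x)) (new_tile c) \<in> new_tile ` children y"
      if "loc \<rho> x = loc \<rho> y" "c \<in> children x" for x y c
      using children_shift[OF that] new_tile_shift[of c "c + \<psi> (y - x)"] by auto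
    note e = translate_new_tile_eqD[OF x(1) y]
    show "\<omega> (translate_tile g T) = translate (\<psi> g) (\<omega> T)"
    proof (intro equalityI subsetI)
      fix S assume "S \<in> \<omega> (translate_tile g T)"
      then obtain c where "c \<in> children y" "S = new_tile c" using x y by (auto simp: \<omega>_def)
      then show "S \<in> translate (\<psi> g) (\<omega> T)"
        using tr[OF e(2)[symmetric], of c] x e(1) linear_neg[OF linear_\<psi>, of g]
        by (simp add: mem_translate \<omega>_def)
    next
      fix S assume "S \<in> translate (\<psi> g) (\<omega> T)"
      then show "S \<in> \<omega> (translate_tile g T)"
        using tr[OF e(2)] x y e(1) by (auto simp: \<omega>_def translate_def)
    qed
  }
qed (rule tiling_new_tiling FLC_new_tiling repetitive_new_tiling)+

text \<open>A tile through \<open>x\<close> belongs to a point within \<open>2 * d\<close>, and the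
  enlarged pattern at \<open>x\<close> contains the type of that point.\<close>

lemma meeting_new_tiling_local:
  assumes "loc (\<rho> + 2 * d) x = loc (\<rho> + 2 * d) y"
  shows "meeting {x} new_tiling = translate (x - y) (meeting {y} new_tiling)"
proof -
  have tr: "translate_tile (y - x) S \<in> meeting {y} new_tiling"
    if l: "loc (\<rho> + 2 * d) x = loc (\<rho> + 2 * d) y" and S: "S \<in> meeting {x} new_tiling" for x y S
  proof -
    obtain z where z: "z \<in> \<Lambda>" "S = new_tile z" "x \<in> A z"
      using S by (auto simp: meeting_def new_tiling_def)
    have "loc \<rho> (x + (z - x)) = loc \<rho> (y + (z - x))"
      by (rule loc_shift[OF l]) (use A_near[OF z(3)] in \<open>simp add: nrm_minus_commute\<close>)
    then have l': "loc \<rho> z = loc \<rho> (z + (y - x))" by (simp add: algebra_simps)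
    have "translate_tile (y - x) S \<in> new_tiling"
      using new_tile_shift[OF l'] loc_\<rho>_\<Lambda>[OF l'] z by (simp add: new_tiling_def)
    then show ?thesis using S by (simp add: meeting_def)
  qed
  show ?thesis
  proof (intro equalityI subsetI)
    fix S assume "S \<in> meeting {x} new_tiling"
    then show "S \<in> translate (x - y) (meeting {y} new_tiling)"
      using tr[OF assms] by (simp add: mem_translate)
  next
    fix S assume "S \<in> translate (x - y) (meeting {y} new_tiling)"
    then show "S \<in> meeting {x} new_tiling" using tr[OF assms[symmetric]] by (auto simp: translate_def)
  qed
qed

text \<open>One tile through \<open>x\<close> suffices: its label records the \<rho>-pattern of a
  point within \<open>2 * d\<close> of \<open>x\<close>, of which radius
  \<open>\<rho>\<^sub>0\<close> is left at \<open>x\<close>. So every nonnegative \<open>R\<close>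
  works.\<close>

lemma loc_local_in_new_tiling:
  assumes "R \<ge> 0"
    and eq: "meeting (nball nrm R x) new_tiling = translate (x - y) (meeting (nball nrm R y) new_tiling)"
  shows "loc \<rho>\<^sub>0 x = loc \<rho>\<^sub>0 y"
proof -
  obtain z where z: "z \<in> \<Lambda>" "x \<in> A z" using A_covers by blast
  then have "new_tile z \<in> meeting (nball nrm R x) new_tiling"
    using \<open>R \<ge> 0\<close> by (auto simp: meeting_def new_tiling_def intro!: exI[of _ x])
  then have "translate_tile (y - x) (new_tile z) \<in> new_tiling"
    unfolding eq by (auto simp: mem_translate meeting_def)
  then obtain z' where z': "z' \<in> \<Lambda>" "translate_tile (y - x) (new_tile z) = new_tile z'"
    by (auto simp: new_tiling_def)
  note e = translate_new_tile_eqD[OF z(1) z']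
  have "loc \<rho>\<^sub>0 (z + (x - z)) = loc \<rho>\<^sub>0 (z' + (x - z))"
    by (rule loc_shift[OF e(2)]) (use A_near[OF z(2)] in \<open>simp add: \<rho>_def\<close>)
  then show ?thesis by (simp add: e(1))
qed

end

section \<open>Patterns of a repetitive tiling of finite local complexity\<close>

locale tiled_space = normed nrm for nrm :: "'v::euclidean_space \<Rightarrow> real" +
  fixes \<T> :: "'v tile set"
  assumes tiling: "tiling \<T>" and FLC: "FLC nrm \<T>" and repetitive: "repetitive nrm \<T>"
begin

text \<open>Moving the centre to the origin turns the translation condition of
  \<open>LD_radius\<close> into plain equality, see \<open>loc_eq_iff\<close>.\<close>

definition loc :: "real \<Rightarrow> 'v \<Rightarrow> 'v tile set" where
  "loc r x = translate (- x) (meeting (nball nrm r x) \<T>)"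

lemma loc_eq_iff:
  "loc r x = loc r y \<longleftrightarrow>
    meeting (nball nrm r x) \<T> = translate (x - y) (meeting (nball nrm r y) \<T>)"
  using translate_eq_iff[of x "loc r x" "loc r y"] by (simp add: loc_def)

lemma mem_loc_iff: "S \<in> loc r x \<longleftrightarrow> translate_tile x S \<in> \<T> \<and> (\<exists>z\<in>fst S. nrm z \<le> r)"
proof -
  have "fst (translate_tile x S) \<inter> nball nrm r x \<noteq> {} \<longleftrightarrow> (\<exists>z\<in>fst S. nrm z \<le> r)"
    by (auto simp: fst_translate_tile)
  then show ?thesis by (auto simp: loc_def mem_translate meeting_def)
qed

lemma loc_shift:
  assumes "loc r x = loc r y" "s + nrm v \<le> r" shows "loc s (x + v) = loc s (y + v)"
proof -
  have "S \<in> loc s (y + v)" if eq: "loc r x = loc r y" and S: "S \<in> loc s (x + v)" for x y S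
  proof -
    obtain z where z: "z \<in> fst S" "nrm z \<le> s" and "translate_tile (x + v) S \<in> \<T>"
      using S by (auto simp: mem_loc_iff)
    moreover have "nrm (z + v) \<le> r" using nrm_add_le[of z v] z(2) assms(2) by simp
    ultimately have "translate_tile v S \<in> loc r x"
      unfolding mem_loc_iff by (auto intro!: bexI[of _ "z + v"])
    then show ?thesis using z eq by (auto simp: mem_loc_iff)
  qed
  from this[OF assms(1)] this[OF assms(1)[symmetric]] show ?thesis by blast
qed

text \<open>A tile that meets the ball at displacement \<open>z\<close> belongs to the 0-pattern at
  \<open>x + z\<close>.\<close>

lemma loc_pointwise:
  assumes "\<And>v. nrm v \<le> s \<Longrightarrow> loc 0 (x + v) = loc 0 (y + v)" shows "loc s x = loc s y"
proof -
  have "S \<in> loc s y"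
    if eq: "\<And>v. nrm v \<le> s \<Longrightarrow> loc 0 (x + v) = loc 0 (y + v)" and S: "S \<in> loc s x" for x y S
  proof -
    obtain z where z: "z \<in> fst S" "nrm z \<le> s" and "translate_tile x S \<in> \<T>"
      using S by (auto simp: mem_loc_iff)
    then have "translate_tile (- z) S \<in> loc 0 (x + z)"
      unfolding mem_loc_iff by (auto intro!: bexI[of _ 0])
    then show ?thesis using z eq[OF z(2)] by (auto simp: mem_loc_iff)
  qed
  from this[OF assms] this[OF assms[symmetric]] show ?thesis by blast
qed

section \<open>Local finiteness of the tiling and recurrence of its patterns\<close>

lemma compact_tile: "T \<in> \<T> \<Longrightarrow> compact (fst T)"
  and closure_interior_tile: "T \<in> \<T> \<Longrightarrow> closure (interior (fst T)) = fst T"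
  using tiling by (auto simp: tiling_def is_tile_def)

lemma tiles_cover: obtains T where "T \<in> \<T>" "x \<in> fst T"
  using tiling unfolding tiling_def supp_def by blast

lemma tile_eqI: "S \<in> \<T> \<Longrightarrow> T \<in> \<T> \<Longrightarrow> interior (fst S) \<inter> interior (fst T) \<noteq> {} \<Longrightarrow> S = T"
  using tiling unfolding tiling_def pairwise_def by blast

text \<open>Let \<open>S\<close> contain a ball of radius \<open>e\<close> in its interior.
  Translates displaced by less than \<open>e\<close> then share interior points and coincide, and
  compactness identifies the vectors.\<close>

lemma tile_translates_separated:
  assumes "S \<in> \<T>" "fst S \<noteq> {}"
  obtains e where "e > 0"
    "\<And>g h. translate_tile g S \<in> \<T> \<Longrightarrow> translate_tile h S \<in> \<T> \<Longrightarrow> nrm (g - h) < e \<Longrightarrow> g = h"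
proof -
  have "interior (fst S) \<noteq> {}" using closure_interior_tile[OF assms(1)] assms(2) by auto
  then obtain c where "c \<in> interior (fst S)" by blast
  then obtain e where e: "e > 0" "nball nrm e c \<subseteq> interior (fst S)"
    by (meson open_contains_nball open_interior)
  show ?thesis
  proof (rule that[OF e(1)])
    fix g h assume gh: "translate_tile g S \<in> \<T>" "translate_tile h S \<in> \<T>" "nrm (g - h) < e"
    have "c + g \<in> interior (fst (translate_tile g S))"
      using \<open>c \<in> interior (fst S)\<close> by simp
    moreover have "c + g - h \<in> nball nrm e c" using gh(3) by simp
    then have "c + g \<in> interior (fst (translate_tile h S))" using e(2) by auto
    ultimately have "translate_tile g S = translate_tile h S" using tile_eqI gh by blast
    then show "g = h"
      using compact_translation_unique[OF compact_tile[OF assms(1)] assms(2)]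
      by (metis fst_translate_tile)
  qed
qed

text \<open>The tiles of one label are translates of a single tile by separated vectors, and those
  meeting the ball have bounded vectors.\<close>

lemma finite_meeting_nball: "finite (meeting (nball nrm r x) \<T>)"
proof -
  obtain m where m: "\<And>T. T \<in> \<T> \<Longrightarrow> snd T \<in> {1..m}"
    using tiling unfolding tiling_def is_tile_def by blast
  have fin: "finite {S \<in> meeting (nball nrm r x) \<T>. snd S = i}" for i
  proof (cases "{S \<in> meeting (nball nrm r x) \<T>. snd S = i} = {}")
    case False
    then obtain S where "S \<in> meeting (nball nrm r x) \<T>" "snd S = i" by blast
    then have S: "S \<in> \<T>" "snd S = i" "fst S \<noteq> {}" by (auto simp: meeting_def)
    obtain e where e: "e > 0"
      "\<And>g h. translate_tile g S \<in> \<T> \<Longrightarrow> translate_tile h S \<in> \<T> \<Longrightarrow> nrm (g - h) < e \<Longrightarrow> g = h"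
      using tile_translates_separated[OF S(1,3)] by blast
    obtain M where M: "\<And>z. z \<in> fst S \<Longrightarrow> nrm z \<le> M"
      using bounded_imp_nrm_le[OF compact_imp_bounded[OF compact_tile[OF S(1)]]] by blast
    define G where "G = {g. translate_tile g S \<in> \<T>} \<inter> nball nrm (nrm x + r + M) 0"
    have "finite G" unfolding G_def by (rule finite_separated_Int_nball[OF e(1)]) (use e(2) in blast)
    moreover have "{S \<in> meeting (nball nrm r x) \<T>. snd S = i} \<subseteq> (\<lambda>g. translate_tile g S) ` G"
    proof
      fix U assume "U \<in> {S \<in> meeting (nball nrm r x) \<T>. snd S = i}"
      then obtain u where U: "U \<in> \<T>" "snd U = i" "u \<in> fst U" "nrm (u - x) \<le> r"
        by (auto simp: meeting_def)
      then obtain g where g: "U = translate_tile g S"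
        using tiling S unfolding tiling_def by metis
      have "nrm g \<le> nrm u + nrm (u - g)" using nrm_diff_le[of u "u - g"] by simp
      moreover have "nrm u \<le> nrm (u - x) + nrm x" using nrm_add_le[of "u - x" x] by simp
      moreover have "nrm (u - g) \<le> M" using M U(3) g by simp
      ultimately have "g \<in> G" using U g by (simp add: G_def)
      then show "U \<in> (\<lambda>g. translate_tile g S) ` G" using g by blast
    qed
    ultimately show ?thesis using finite_surj by blast
  qed (simp only: finite.emptyI)
  have "meeting (nball nrm r x) \<T> \<subseteq> (\<Union>i\<in>{1..m}. {S \<in> meeting (nball nrm r x) \<T>. snd S = i})"
  proof
    fix T assume T: "T \<in> meeting (nball nrm r x) \<T>"
    then have "snd T \<in> {1..m}" by (intro m) (simp add: meeting_def)
    then show "T \<in> (\<Union>i\<in>{1..m}. {S \<in> meeting (nball nrm r x) \<T>. snd S = i})" using T by blast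
  qed
  then show ?thesis using fin by (meson finite_UN_I finite_atLeastAtMost finite_subset)
qed

lemma tile_diameter_bounded:
  obtains M where "M > 0" "\<And>S u v. S \<in> \<T> \<Longrightarrow> u \<in> fst S \<Longrightarrow> v \<in> fst S \<Longrightarrow> nrm (u - v) \<le> M"
proof -
  obtain m where m: "\<And>T. T \<in> \<T> \<Longrightarrow> snd T \<in> {1..m}"
    using tiling unfolding tiling_def is_tile_def by blast
  have "\<exists>M>0. \<forall>S\<in>\<T>. snd S = i \<longrightarrow> (\<forall>u\<in>fst S. \<forall>v\<in>fst S. nrm (u - v) \<le> M)" for i
  proof (cases "\<exists>S\<in>\<T>. snd S = i")
    case True
    then obtain S where S: "S \<in> \<T>" "snd S = i" by blast
    obtain M where M: "M > 0" "\<And>z. z \<in> fst S \<Longrightarrow> nrm z \<le> M"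
      using bounded_imp_nrm_le[OF compact_imp_bounded[OF compact_tile[OF S(1)]]] by blast
    have "nrm (u - v) \<le> 2 * M" if U: "U \<in> \<T>" "snd U = i" "u \<in> fst U" "v \<in> fst U" for U u v
    proof -
      obtain g where g: "U = translate_tile g S"
        using U S tiling unfolding tiling_def by metis
      then have "nrm (u - g) \<le> M" "nrm (v - g) \<le> M" using U M(2) by auto
      then show ?thesis using nrm_diff_triangle[of u v g] nrm_minus_commute[of g v] by simp
    qed
    then show ?thesis using M(1) by (intro exI[of _ "2 * M"]) auto
  qed (auto intro!: exI[of _ 1])
  then obtain M where M: "\<And>i. M i > 0"
    "\<And>i S u v. S \<in> \<T> \<Longrightarrow> snd S = i \<Longrightarrow> u \<in> fst S \<Longrightarrow> v \<in> fst S \<Longrightarrow> nrm (u - v) \<le> M i"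
    by metis
  show ?thesis
  proof
    show "(\<Sum>i\<in>{1..m}. M i) + 1 > 0" using M(1) by (simp add: add_nonneg_pos less_imp_le sum_nonneg)
    fix S u v assume S: "S \<in> \<T>" "u \<in> fst S" "v \<in> fst S"
    have "M (snd S) \<le> (\<Sum>i\<in>{1..m}. M i)"
      by (rule member_le_sum[OF m[OF S(1)]]) (use M(1) in \<open>auto intro: less_imp_le\<close>)
    then show "nrm (u - v) \<le> (\<Sum>i\<in>{1..m}. M i) + 1" using M(2)[OF S(1) refl S(2,3)] by linarith
  qed
qed

text \<open>Only finitely many tiles near \<open>w\<close> miss the ball. Deleting their closed
  union leaves a neighbourhood of \<open>w\<close> that is covered by tiles meeting the
  ball.\<close>

lemma nball_subset_interior_supp:
  "nball nrm r x \<subseteq> interior (supp (meeting (nball nrm r x) \<T>))"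
proof
  fix w assume w: "w \<in> nball nrm r x"
  define N where "N = meeting (nball nrm (r + 1) x) \<T> - meeting (nball nrm r x) \<T>"
  define W where "W = {p. nrm (p - w) < 1} - (\<Union>T\<in>N. fst T)"
  have "finite N" "N \<subseteq> \<T>" using finite_meeting_nball by (auto simp: N_def meeting_def)
  then have "closed (\<Union>T\<in>N. fst T)" by (intro closed_UN) (auto intro: compact_imp_closed compact_tile)
  then have "open W" unfolding W_def by (intro open_Diff open_nball_less)
  moreover have "w \<in> W" using w by (auto simp: W_def N_def meeting_def)
  moreover have "W \<subseteq> supp (meeting (nball nrm r x) \<T>)"
  proof
    fix p assume p: "p \<in> W"
    obtain T where T: "T \<in> \<T>" "p \<in> fst T" by (rule tiles_cover)
    have "nrm (p - x) \<le> r + 1"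
      using nrm_diff_triangle[of p x w] p w by (simp add: W_def)
    then have "T \<in> meeting (nball nrm (r + 1) x) \<T>" using T by (auto simp: meeting_def)
    then show "p \<in> supp (meeting (nball nrm r x) \<T>)"
      using p T(2) by (auto simp: W_def N_def supp_def)
  qed
  ultimately show "w \<in> interior (supp (meeting (nball nrm r x) \<T>))" by (meson interiorI)
qed

text \<open>Being the closure of its interior, \<open>S\<close> has interior points where
  \<open>P\<close> covers. Some tile of \<open>P\<close> then contains an open part of
  \<open>S\<close> and equals \<open>S\<close>.\<close>

lemma patch_contains_meeting_tile:
  assumes "patch \<T> P" "S \<in> \<T>" "u \<in> fst S" "u \<in> interior (supp P)"
  shows "S \<in> P"
proof -
  have P: "finite P" "P \<subseteq> \<T>" using assms(1) by (auto simp: patch_def)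
  define U where "U = interior (supp P) \<inter> interior (fst S)"
  have "u \<in> closure (interior (fst S))" using closure_interior_tile assms(2,3) by simp
  then have "U \<noteq> {}" using assms(4) open_interior
    unfolding U_def by (metis closure_iff_nhds_not_empty inf_commute order_refl)
  moreover have "U \<subseteq> (\<Union>T\<in>P. fst T)" using interior_subset by (auto simp: U_def supp_def)
  ultimately obtain T V where T: "T \<in> P" "open V" "V \<noteq> {}" "V \<subseteq> U" "V \<subseteq> fst T"
    using open_subset_finite_UN_closed[OF P(1), of fst U] P(2) compact_tile compact_imp_closed
    by (metis U_def open_Int open_interior subsetD)
  then have "V \<subseteq> interior (fst S) \<inter> interior (fst T)"
    by (auto simp: U_def interior_maximal)
  then have "S = T" using tile_eqI[of S T] T P(2) assms(2) by blast
  then show ?thesis using T(1) by simp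
qed

text \<open>Repetitivity alone gives a copy of the patch, which might be only part of the pattern
  there. No further tile meets the copied ball, because the copy covers a neighbourhood of each of
  its points.\<close>

lemma loc_recurs: "\<exists>L. \<forall>z. \<exists>y. nrm (y - z) \<le> L \<and> loc r x = loc r y"
proof -
  \<comment> \<open>The absolute value keeps the centre inside the ball when \<open>r\<close> is
    negative.\<close>
  define P where "P = meeting (nball nrm \<bar>r\<bar> x) \<T>"
  have "patch \<T> P" using finite_meeting_nball by (auto simp: P_def patch_def meeting_def)
  then obtain L where L: "\<And>z. \<exists>P'. patch \<T> P' \<and> (\<exists>g. P' = translate g P) \<and> supp P' \<subseteq> nball nrm L z"
    using repetitive unfolding repetitive_def by meson
  have "\<exists>y. nrm (y - z) \<le> L \<and> loc r x = loc r y" for z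
  proof -
    obtain g where g: "patch \<T> (translate g P)" "supp (translate g P) \<subseteq> nball nrm L z"
      using L[of z] by blast
    have int: "w + g \<in> interior (supp (translate g P))" if "w \<in> nball nrm \<bar>r\<bar> x" for w
    proof -
      have "supp (translate g P) = (+) g ` supp P"
        by (auto simp: mem_supp_translate image_iff) (metis add.commute diff_add_cancel)
      moreover have "w \<in> interior (supp P)" unfolding P_def by (rule subsetD[OF nball_subset_interior_supp that])
      ultimately have "g + w \<in> interior (supp (translate g P))"
        by (simp only: interior_translation) (rule imageI)
      then show ?thesis by (simp add: add.commute)
    qed
    have "meeting (nball nrm \<bar>r\<bar> (x + g)) \<T> = translate g P"
    proof (intro equalityI subsetI)
      fix S assume "S \<in> meeting (nball nrm \<bar>r\<bar> (x + g)) \<T>"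
      then obtain u where u: "S \<in> \<T>" "u \<in> fst S" "nrm (u - (x + g)) \<le> \<bar>r\<bar>"
        by (auto simp: meeting_def)
      then have "u - g \<in> nball nrm \<bar>r\<bar> x" by (simp add: algebra_simps)
      from int[OF this] show "S \<in> translate g P"
        by (intro patch_contains_meeting_tile[OF g(1) u(1,2)]) simp
    next
      fix S assume S: "S \<in> translate g P"
      then obtain u where "u \<in> fst (translate_tile (- g) S)" "nrm (u - x) \<le> \<bar>r\<bar>"
        by (auto simp: mem_translate P_def meeting_def)
      then have "u + g \<in> fst S" "u + g \<in> nball nrm \<bar>r\<bar> (x + g)" by auto
      then show "S \<in> meeting (nball nrm \<bar>r\<bar> (x + g)) \<T>"
        using S g(1) by (auto simp: meeting_def patch_def)
    qed
    then have "loc \<bar>r\<bar> (x + g) = loc \<bar>r\<bar> x" by (simp add: loc_eq_iff P_def)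
    then have "loc r x = loc r (x + g)"
      using loc_shift[of "\<bar>r\<bar>" x "x + g" r 0] by simp
    moreover have "x + g \<in> nball nrm L z"
      by (rule subsetD[OF g(2)], rule subsetD[OF interior_subset], rule int) simp
    ultimately show ?thesis by auto
  qed
  then show ?thesis by blast
qed

section \<open>The return points of the origin\<close>

definition \<Lambda> :: "'v set" where "\<Lambda> = {x. loc 0 x = loc 0 0}"

text \<open>A tile that accompanies every point of \<Lambda>: its translates yield the separation of
  \<Lambda> and locate the centre of a pattern in \<open>finite_loc\<close>.\<close>

lemma marker_tile: "\<exists>S\<in>\<T>. 0 \<in> fst S \<and> (\<forall>x\<in>\<Lambda>. translate_tile x S \<in> \<T>)"
proof -
  obtain S where S: "S \<in> \<T>" "0 \<in> fst S" by (rule tiles_cover)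
  then have "S \<in> loc 0 0" by (auto simp: mem_loc_iff intro!: bexI[of _ 0])
  then have "translate_tile x S \<in> \<T>" if "x \<in> \<Lambda>" for x
    using that mem_loc_iff unfolding \<Lambda>_def by blast
  then show ?thesis using S by blast
qed

text \<open>FLC counts patches up to translation and so forgets where the centre is. The marker tile
  restores it: its copy at the centre is one of the finitely many tiles of the representative of the
  class.\<close>

lemma finite_loc: "finite (loc r ` \<Lambda>)"
proof (cases "r \<ge> 0")
  case False
  then have "loc r x = {}" for x using mem_loc_iff by (meson equals0I nrm_nonneg order_trans)
  then show ?thesis by (auto intro: finite_subset[of _ "{{}}"])
next
  case True
  obtain S where S: "S \<in> \<T>" "fst S \<noteq> {}" "0 \<in> fst S" "\<And>x. x \<in> \<Lambda> \<Longrightarrow> translate_tile x S \<in> \<T>"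
    using marker_tile by (metis empty_iff)
  obtain M where M: "M > 0" "\<And>S u v. S \<in> \<T> \<Longrightarrow> u \<in> fst S \<Longrightarrow> v \<in> fst S \<Longrightarrow> nrm (u - v) \<le> M"
    using tile_diameter_bounded by blast
  \<comment> \<open>A pattern has diameter at most \<open>2 * (M + r)\<close>; the
    \<open>+ 1\<close> serves the strict inequality in \<open>FLC\<close>.\<close>
  define D where "D = 2 * (M + r) + 1"
  define C where "C = {P. patch \<T> P \<and> ndiameter nrm (supp P) < D} // translation_equiv"
  have "finite C" using FLC M(1) True unfolding FLC_def C_def D_def by simp
  define q where "q X = (SOME P. P \<in> X)" for X :: "'v tile set set"
  \<comment> \<open>The possible positions of the marker, hence of the centre, in the
    representative.\<close>
  define H where "H X = {h. translate_tile h S \<in> q X}" for X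
  have q: "\<exists>g. q (translation_equiv `` {P}) = translate g P" for P
  proof -
    have "P \<in> translation_equiv `` {P}" by (auto simp: translation_equiv_def intro!: exI[of _ 0])
    then have "q (translation_equiv `` {P}) \<in> translation_equiv `` {P}"
      unfolding q_def by (metis someI)
    then show ?thesis by (auto simp: translation_equiv_def)
  qed
  have "finite (H X)" if X: "X \<in> C" for X
  proof -
    obtain P where P: "patch \<T> P" "X = translation_equiv `` {P}"
      using X unfolding C_def quotient_def by blast
    then obtain g where "q X = translate g P" using q by blast
    then have "finite (q X)" using P(1) by (simp add: patch_def translate_def)
    moreover have "inj (\<lambda>h. translate_tile h S)"
    proof (rule injI)
      fix g h assume "translate_tile g S = translate_tile h S"
      then have "(\<lambda>x. x + g) ` fst S = (\<lambda>x. x + h) ` fst S" by (metis fst_translate_tile)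
      then show "g = h" by (rule compact_translation_unique[OF compact_tile[OF S(1)] S(2)])
    qed
    ultimately show ?thesis
      unfolding H_def using finite_vimageI[of "q X" "\<lambda>h. translate_tile h S"] by (simp add: vimage_def)
  qed
  then have "finite (\<Union>X\<in>C. (\<lambda>h. translate (- h) (q X)) ` H X)" using \<open>finite C\<close> by blast
  moreover have "loc r ` \<Lambda> \<subseteq> (\<Union>X\<in>C. (\<lambda>h. translate (- h) (q X)) ` H X)"
  proof
    fix l assume "l \<in> loc r ` \<Lambda>"
    then obtain x where x: "x \<in> \<Lambda>" "l = loc r x" by blast
    define P where "P = meeting (nball nrm r x) \<T>"
    have near: "nrm (u - x) \<le> M + r" if u: "u \<in> supp P" for u
    proof -
      obtain T p where "T \<in> \<T>" "u \<in> fst T" "p \<in> fst T" "nrm (p - x) \<le> r"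
        using u by (auto simp: P_def supp_def meeting_def)
      then show ?thesis using M(2)[of T u p] nrm_diff_triangle[of u x p] by simp
    qed
    have "ndiameter nrm (supp P) \<le> 2 * (M + r)"
    proof (rule ndiameter_le)
      fix u v assume "u \<in> supp P" "v \<in> supp P"
      then show "nrm (u - v) \<le> 2 * (M + r)"
        using near[of u] near[of v] nrm_diff_triangle[of u v x] nrm_minus_commute[of x v] by simp
    qed (use M(1) True in simp)
    then have "ndiameter nrm (supp P) < D" by (simp add: D_def)
    moreover have "patch \<T> P"
      using finite_meeting_nball by (auto simp: P_def patch_def meeting_def)
    ultimately have X: "translation_equiv `` {P} \<in> C" unfolding C_def by (intro quotientI) simp
    obtain g where g: "q (translation_equiv `` {P}) = translate g P" using q by blast
    have "x \<in> fst (translate_tile x S) \<inter> nball nrm r x" using S(3) True by simp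
    then have "translate_tile x S \<in> P"
      using S(4)[OF x(1)] unfolding P_def meeting_def by blast
    then have "x + g \<in> H (translation_equiv `` {P})"
      by (simp add: H_def g mem_translate)
    moreover have "l = translate (- (x + g)) (q (translation_equiv `` {P}))"
      by (simp add: g x(2) loc_def flip: P_def)
    ultimately show "l \<in> (\<Union>X\<in>C. (\<lambda>h. translate (- h) (q X)) ` H X)" using X by blast
  qed
  ultimately show ?thesis by (rule finite_subset[rotated])
qed

lemma pattern_exists: obtains \<delta> d where "pattern nrm loc \<Lambda> \<delta> d"
proof -
  obtain S where S: "S \<in> \<T>" "fst S \<noteq> {}" "0 \<in> fst S" "\<And>x. x \<in> \<Lambda> \<Longrightarrow> translate_tile x S \<in> \<T>"
    using marker_tile by (metis empty_iff)
  obtain \<delta> where \<delta>: "\<delta> > 0"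
    "\<And>g h. translate_tile g S \<in> \<T> \<Longrightarrow> translate_tile h S \<in> \<T> \<Longrightarrow> nrm (g - h) < \<delta> \<Longrightarrow> g = h"
    using tile_translates_separated[OF S(1,2)] by blast
  obtain L where L: "\<And>z. \<exists>y. nrm (y - z) \<le> L \<and> loc 0 0 = loc 0 y" using loc_recurs by blast
  have "pattern nrm loc \<Lambda> \<delta> (\<bar>L\<bar> + 1)"
  proof
    show "\<exists>x\<in>\<Lambda>. nrm (x - z) \<le> \<bar>L\<bar> + 1" for z
    proof -
      obtain y where "nrm (y - z) \<le> L" "loc 0 0 = loc 0 y" using L by blast
      then show ?thesis by (intro bexI[of _ y]) (auto simp: \<Lambda>_def)
    qed
    show "x = y" if "x \<in> \<Lambda>" "y \<in> \<Lambda>" "nrm (x - y) < \<delta>" for x y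
      using \<delta>(2) S(4) that by blast
    show "x \<in> \<Lambda> \<longleftrightarrow> y \<in> \<Lambda>" if "loc 0 x = loc 0 y" for x y
      using that by (simp add: \<Lambda>_def)
    show "0 < \<delta>" "0 < \<bar>L\<bar> + 1" using \<delta>(1) by simp_all
  qed (fact loc_shift finite_loc loc_recurs)+
  then show ?thesis using that by blast
qed

text \<open>The 0-pattern at an image point needs only the (R/c)-pattern at its preimage. The offset
  \<open>t = R / (c - 1)\<close> solves \<open>t = (R + t) / c\<close>, so it reproduces itself
  while \<open>r\<close> is multiplied by \<open>c\<close>; iteration therefore never increases
  it.\<close>

lemma inflation:
  assumes "linear \<phi>" and c: "c > 1" "\<And>g. c * nrm g \<le> nrm (\<phi> g)"
    and LD: "LD_radius nrm R \<T> (image_tiling \<phi> \<T>)"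
    and eq: "loc (R / (c - 1) + r) x = loc (R / (c - 1) + r) y"
  shows "loc (R / (c - 1) + c * r) (\<phi> x) = loc (R / (c - 1) + c * r) (\<phi> y)"
proof -
  have sub: "translate_tile (\<phi> y - \<phi> x) S \<in> meeting (nball nrm R (\<phi> y)) (image_tiling \<phi> \<T>)"
    if eq: "loc (R / c) x = loc (R / c) y"
      and S: "S \<in> meeting (nball nrm R (\<phi> x)) (image_tiling \<phi> \<T>)" for x y S
  proof -
    have "S \<in> image_tiling \<phi> \<T>" "fst S \<inter> nball nrm R (\<phi> x) \<noteq> {}"
      using S by (simp_all add: meeting_def)
    then obtain U u where U: "U \<in> \<T>" "S = (\<phi> ` fst U, snd U)" "u \<in> fst U" "nrm (\<phi> u - \<phi> x) \<le> R"
      unfolding image_tiling_def by force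
    have "c * nrm (u - x) \<le> R"
      using c(2)[of "u - x"] U(4) linear_diff[OF assms(1)] by simp
    then have "nrm (u - x) \<le> R / c" using c(1) by (simp add: field_simps)
    then have "translate_tile (- x) U \<in> loc (R / c) x"
      using U by (auto simp: mem_loc_iff intro!: bexI[of _ "u - x"])
    then have "translate_tile (- x) U \<in> loc (R / c) y" using eq by simp
    then have U': "translate_tile (y - x) U \<in> \<T>" by (simp add: mem_loc_iff)
    have "\<phi> z + (\<phi> y - \<phi> x) = \<phi> (z + (y - x))" for z
      using assms(1) by (simp add: linear_add linear_diff)
    then have "translate_tile (\<phi> y - \<phi> x) S
        = (\<phi> ` fst (translate_tile (y - x) U), snd (translate_tile (y - x) U))"
      by (simp add: U(2) translate_tile_def image_image)
    then have "translate_tile (\<phi> y - \<phi> x) S \<in> image_tiling \<phi> \<T>"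
      using U' unfolding image_tiling_def by blast
    moreover have "\<phi> u + (\<phi> y - \<phi> x) \<in> fst (translate_tile (\<phi> y - \<phi> x) S)"
      using U by simp
    moreover have "\<phi> u + (\<phi> y - \<phi> x) \<in> nball nrm R (\<phi> y)" using U(4) by simp
    ultimately show ?thesis unfolding meeting_def by blast
  qed
  \<comment> \<open>By expansion, every tile of the inflated tiling within \<open>R\<close> of the
    image of \<open>x\<close> comes from a tile within \<open>R / c\<close> of
    \<open>x\<close>.\<close>
  have step: "loc 0 (\<phi> x) = loc 0 (\<phi> y)" if eq: "loc (R / c) x = loc (R / c) y" for x y
  proof -
    have "meeting (nball nrm R (\<phi> x)) (image_tiling \<phi> \<T>)
        = translate (\<phi> x - \<phi> y) (meeting (nball nrm R (\<phi> y)) (image_tiling \<phi> \<T>))"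
    proof (intro equalityI subsetI)
      fix S assume "S \<in> meeting (nball nrm R (\<phi> x)) (image_tiling \<phi> \<T>)"
      from sub[OF eq this]
      show "S \<in> translate (\<phi> x - \<phi> y) (meeting (nball nrm R (\<phi> y)) (image_tiling \<phi> \<T>))"
        by (simp add: mem_translate)
    next
      fix S assume "S \<in> translate (\<phi> x - \<phi> y) (meeting (nball nrm R (\<phi> y)) (image_tiling \<phi> \<T>))"
      then show "S \<in> meeting (nball nrm R (\<phi> x)) (image_tiling \<phi> \<T>)"
        using sub[OF eq[symmetric]] unfolding translate_def by blast
    qed
    then show ?thesis using LD unfolding LD_radius_def loc_eq_iff nball_0 by blast
  qed
  show ?thesis
  proof (rule loc_pointwise)
    fix v assume v: "nrm v \<le> R / (c - 1) + c * r"
    have "surj \<phi>"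
    proof (rule linear_inj_imp_surj[OF assms(1)])
      have "g = 0" if "\<phi> g = 0" for g
        using c(2)[of g] that c(1) nrm_nonneg[of g] by (simp add: mult_le_0_iff)
      then show "inj \<phi>" using assms(1) by (simp add: linear_injective_0)
    qed
    then obtain w where w: "v = \<phi> w" by blast
    have "c * nrm w \<le> R / (c - 1) + c * r" using c(2)[of w] v w by simp
    then have "R / c + nrm w \<le> R / (c - 1) + r" using c(1) by (simp add: field_simps)
    then have "loc (R / c) (x + w) = loc (R / c) (y + w)" by (rule loc_shift[OF eq])
    then show "loc 0 (\<phi> x + v) = loc 0 (\<phi> y + v)"
      using step[of "x + w" "y + w"] by (simp add: w linear_add[OF assms(1)])
  qed
qed

lemma inflation_funpow:
  assumes "linear \<phi>" and c: "c > 1" "\<And>g. c * nrm g \<le> nrm (\<phi> g)"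
    and LD: "LD_radius nrm R \<T> (image_tiling \<phi> \<T>)"
    and eq: "loc (R / (c - 1) + r) x = loc (R / (c - 1) + r) y"
  shows "loc (R / (c - 1) + c ^ k * r) ((\<phi> ^^ k) x) = loc (R / (c - 1) + c ^ k * r) ((\<phi> ^^ k) y)"
proof (induction k)
  case (Suc k)
  from inflation[OF assms(1-4) Suc] show ?case by (simp add: mult.assoc)
qed (simp add: eq)

end

section \<open>Choice of the threshold and conclusion\<close>

theorem theorem3p1:
  fixes \<phi> :: "real ^ 'n \<Rightarrow> real ^ 'n"
    and nrm :: "real ^ 'n \<Rightarrow> real"
    and \<T> :: "(real ^ 'n) tile set"
  assumes "expanding \<phi>"
    and "adapted_norm \<phi> nrm"
    and "pseudo_self_affine nrm \<phi> \<T>"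
  shows "\<exists>k\<^sub>0. \<forall>k\<ge>k\<^sub>0. \<exists>\<T>' :: (real ^ 'n) tile set.
           self_affine nrm (\<phi> ^^ k) \<T>' \<and> MLD nrm \<T> \<T>'"
proof -
  have lin: "linear \<phi>" using assms(1) by (simp add: expanding_def)
  obtain c where c: "c > 1" "\<And>g. c * nrm g \<le> nrm (\<phi> g)" and "is_norm nrm"
    using assms(2) by (auto simp: adapted_norm_def)
  interpret tiled_space nrm \<T>
    using assms(3) \<open>is_norm nrm\<close> by unfold_locales (auto simp: pseudo_self_affine_def)
  obtain R where R: "R > 0" "LD_radius nrm R \<T> (image_tiling \<phi> \<T>)"
    using assms(3) by (auto simp: pseudo_self_affine_def LD_def)
  obtain \<delta> d where "pattern nrm loc \<Lambda> \<delta> d" by (rule pattern_exists)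
  then interpret pattern nrm loc \<Lambda> \<delta> d .
  define \<rho>\<^sub>0 where "\<rho>\<^sub>0 = R / (c - 1)"
  obtain L where L: "L > 0"
    "\<And>x z. x \<in> \<Lambda> \<Longrightarrow> \<exists>y. nrm (y - z) \<le> L \<and> loc (\<rho>\<^sub>0 + 6 * d) x = loc (\<rho>\<^sub>0 + 6 * d) y"
    using loc_recurs_uniform by blast
  \<comment> \<open>All other constants are fixed by now, so one threshold for the growing
    \<open>c ^ k\<close> secures both \<open>\<kappa>_ge\<close> and
    \<open>\<kappa>_large\<close>.\<close>
  obtain k\<^sub>0 where k\<^sub>0: "max 2 ((L + 4 * d) / (\<delta> / 2)) < c ^ k\<^sub>0"
    using real_arch_pow[OF c(1)] by blast
  show ?thesis
  proof (intro exI[of _ k\<^sub>0] allI impI)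
    fix k assume "k \<ge> k\<^sub>0"
    then have "max 2 ((L + 4 * d) / (\<delta> / 2)) < c ^ k"
      using k\<^sub>0 power_increasing[of k\<^sub>0 k c] c(1) by linarith
    then have big: "2 \<le> c ^ k" "L + 4 * d < c ^ k * (\<delta> / 2)"
      using \<delta>_pos by (auto simp: field_simps)
    have lin_k: "linear (\<phi> ^^ k)" using lin by (rule linear_funpow)
    have exp_k: "c ^ k * nrm g \<le> nrm ((\<phi> ^^ k) g)" for g
      using c by (intro funpow_expands) auto
    interpret substitution nrm loc \<Lambda> \<delta> d "\<phi> ^^ k" "c ^ k" \<rho>\<^sub>0 L
    proof (intro substitution.intro substitution_axioms.intro)
      show "pattern nrm loc \<Lambda> \<delta> d" by (rule pattern_axioms)
      show "0 \<le> \<rho>\<^sub>0" using R(1) c(1) by (simp add: \<rho>\<^sub>0_def)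
      show "loc (\<rho>\<^sub>0 + c ^ k * r) ((\<phi> ^^ k) x) = loc (\<rho>\<^sub>0 + c ^ k * r) ((\<phi> ^^ k) y)"
        if "loc (\<rho>\<^sub>0 + r) x = loc (\<rho>\<^sub>0 + r) y" for r x y
        using inflation_funpow[OF lin c R(2), folded \<rho>\<^sub>0_def, OF that] .
    qed (fact lin_k exp_k big L(2))+
    have "LD_radius nrm (\<rho> + 2 * d) new_tiling \<T>"
      unfolding LD_radius_def loc_eq_iff[symmetric] using meeting_new_tiling_local by blast
    moreover have "\<rho> + 2 * d > 0" using \<rho>_nonneg d_pos by simp
    \<comment> \<open>The radius 1 is an arbitrary positive choice, since a single labelled tile
      through \<open>x\<close> already determines the pattern.\<close>
    moreover have "LD_radius nrm 1 \<T> new_tiling"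
      unfolding LD_radius_def
    proof (intro allI impI)
      fix x y
      assume "meeting (nball nrm 1 x) new_tiling = translate (x - y) (meeting (nball nrm 1 y) new_tiling)"
      then have "loc \<rho>\<^sub>0 x = loc \<rho>\<^sub>0 y" by (intro loc_local_in_new_tiling[of 1]) simp_all
      then have "loc 0 x = loc 0 y" by (rule loc_mono) (rule \<rho>\<^sub>0_nonneg)
      then show "meeting {x} \<T> = translate (x - y) (meeting {y} \<T>)"
        by (simp add: loc_eq_iff nball_0)
    qed
    ultimately have "MLD nrm \<T> new_tiling"
      unfolding MLD_def LD_def by (metis zero_less_one)
    then show "\<exists>\<T>'. self_affine nrm (\<phi> ^^ k) \<T>' \<and> MLD nrm \<T> \<T>'"
      using self_affine_new_tiling by blast
  qed
qed

end
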